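(* Let $K$ be a cubic field whose discriminant $d_K$ is fundamental and satisfies $3\nmid d_K$. Let $F_K=(a,b,c,d)$ be a binary cubic form in the $\mathrm{GL}_2(\mathbb{Z})$-equivalence class associated to $K$, with Hessian $H_K=(P,Q,R)$, $P=b^2-3ac$, $Q=bc-9ad$, $R=c^2-3bd$. Let $\frac12 q_K$ denote the binary quadratic form $x\mapsto \frac12\mathrm{tr}_{K/\mathbb{Q}}(x^2)$ on $O_K^0$ written in the following $\mathbb{Z}$-basis of $O_K^0$: $\{\alpha_0,3\beta_0\}$ if $b\equiv 0\pmod 3$; $\{3\alpha_0,\beta_0\}$ if $c\equiv 0 \pmod 3$; $\{\alpha_0-\beta_0,3\beta_0\}$ if $b\equiv -c\pmod 3$; $\{\alpha_0+\beta_0,3\beta_0\}$ if $b\equiv c\pmod 3$. Let $C_{d_K}=(3,0,\frac{d_K}{4})$ if $d_K\equiv 0\pmod 4$ and $C_{d_K}=(3,3,\frac{d_K+3}{4})$ if $d_K\equiv 1\pmod 4$. Then $$\tfrac12 q_K * C_{d_K} = H_K^{\pm 1}$$ as elements of the narrow class group $\mathrm{Cl}^+_{\mathbb{Q}(\sqrt{-3d_K})}$.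
   Context: A discriminant is fundamental if it is the discriminant of a quadratic field. $(A,B,C)$ denotes the binary quadratic form $Ax^2+Bxy+Cy^2$ (discriminant $B^2-4AC$), and $(a,b,c,d)$ the binary cubic form $ax^3+bx^2y+cxy^2+dy^3$. By the Delone–Faddeev correspondence, to a cubic field $K$ is associated an integral binary cubic form $F_K=(a,b,c,d)$, unique up to $\mathrm{GL}_2(\mathbb{Z})$-equivalence, with discriminant $d_K$, such that if $\theta$ is a root of $F_K(x,1)$ then $K=\mathbb{Q}(\theta)$ and $\{1,-a\theta, d/\theta\}$ is a $\mathbb{Z}$-basis of $O_K$. Put $\alpha=-a\theta$, $\beta=d/\theta$, $\alpha_0=\alpha-\frac{\mathrm{tr}_{K/\mathbb{Q}}(\alpha)}{3}$, $\beta_0=\beta-\frac{\mathrm{tr}_{K/\mathbb{Q}}(\beta)}{3}$. $O_K^0=\{x\in O_K:\mathrm{tr}_{K/\mathbb{Q}}(x)=0\}$. The narrow class group $\mathrm{Cl}^+_{\mathbb{Q}(\sqrt{\Delta})}$ is identified, via Gauss composition $*$, with the group of $\mathrm{SL}_2(\mathbb{Z})$-classes of primitive integral binary quadratic forms of discriminant $\Delta$. *)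

theory Defs
  imports
    "Jordan_Normal_Form.Determinant"
    "HOL-Algebra.Group"
    "HOL-Number_Theory.Cong"
    "HOL-Computational_Algebra.Computational_Algebra"
    "HOL.Complex"
begin

section \<open>Number fields\<close>

text \<open>Number fields are subfields of an arbitrary ambient field of characteristic zero; taking
  \<open>UNIV\<close> as the subfield covers the abstract ones.\<close>

global_interpretation ratvs: Vector_Spaces.vector_space
  "\<lambda>(q::rat) (x::'a::field_char_0). of_rat q * x"
  by unfold_locales (simp_all add: of_rat_add of_rat_mult algebra_simps)

global_interpretation intmod: Modules.module
  "\<lambda>(n::int) (x::'a::field_char_0). of_int n * x"
  by unfold_locales (simp_all add: algebra_simps)

definition is_subfield :: "'a::field_char_0 set \<Rightarrow> bool" where
  "is_subfield K \<longleftrightarrow>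
     1 \<in> K \<and> (\<forall>x\<in>K. \<forall>y\<in>K. x - y \<in> K \<and> x * y \<in> K) \<and> (\<forall>x\<in>K. inverse x \<in> K)"

text \<open>As \<open>ratvs.dim\<close> is \<open>0\<close> for infinite-dimensional spaces, only \<open>n > 0\<close> is meaningful.\<close>

definition number_field_deg :: "nat \<Rightarrow> 'a::field_char_0 set \<Rightarrow> bool" where
  "number_field_deg n K \<longleftrightarrow> is_subfield K \<and> ratvs.dim K = n"

abbreviation quadratic_field :: "'a::field_char_0 set \<Rightarrow> bool" where
  "quadratic_field \<equiv> number_field_deg 2"

abbreviation cubic_field :: "'a::field_char_0 set \<Rightarrow> bool" where
  "cubic_field \<equiv> number_field_deg 3"

definition rat_adjoin :: "'a::field_char_0 \<Rightarrow> 'a set" where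
  "rat_adjoin \<theta> = \<Inter>{L. is_subfield L \<and> \<theta> \<in> L}"

text \<open>The trace of multiplication by \<open>x\<close> on the rational vector space \<open>K\<close>, read off from the
  diagonal of its matrix in some basis.\<close>

definition field_trace :: "'a::field_char_0 set \<Rightarrow> 'a \<Rightarrow> rat" where
  "field_trace K x =
     (let B = (SOME B. ratvs.independent B \<and> ratvs.span B = K)
      in \<Sum>b\<in>B. ratvs.representation B (x * b) b)"

definition ring_of_integers :: "'a::field_char_0 set \<Rightarrow> 'a set" where
  "ring_of_integers K = {x \<in> K. algebraic_int x}"

definition trace_zero_integers :: "'a::field_char_0 set \<Rightarrow> 'a set" where
  "trace_zero_integers K = {x \<in> ring_of_integers K. field_trace K x = 0}"

definition int_basis :: "'a::field_char_0 list \<Rightarrow> 'a set \<Rightarrow> bool" where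
  "int_basis ws M \<longleftrightarrow>
     distinct ws \<and> intmod.independent (set ws) \<and> intmod.span (set ws) = M"

text \<open>The determinant does not depend on the integral basis, so the relation below is functional
  on number fields.\<close>

definition has_discriminant :: "'a::field_char_0 set \<Rightarrow> int \<Rightarrow> bool" where
  "has_discriminant K D \<longleftrightarrow>
     (\<exists>ws. int_basis ws (ring_of_integers K) \<and>
        of_int D = Determinant.det (mat (length ws) (length ws)
                     (\<lambda>(i, j). field_trace K (ws ! i * ws ! j))))"

definition fundamental_discriminant :: "int \<Rightarrow> bool" where
  "fundamental_discriminant D \<longleftrightarrow>
     (\<exists>L :: complex set. quadratic_field L \<and> has_discriminant L D)"


section \<open>Binary cubic forms\<close>

type_synonym cubic_form = "int \<times> int \<times> int \<times> int"

fun cubic_eval :: "cubic_form \<Rightarrow> 'a::comm_ring_1 \<Rightarrow> 'a \<Rightarrow> 'a" where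
  "cubic_eval (a, b, c, d) x y =
     of_int a * x ^ 3 + of_int b * x ^ 2 * y + of_int c * x * y ^ 2 + of_int d * y ^ 3"

fun cubic_disc :: "cubic_form \<Rightarrow> int" where
  "cubic_disc (a, b, c, d) =
     b ^ 2 * c ^ 2 - 4 * a * c ^ 3 - 4 * b ^ 3 * d - 27 * a ^ 2 * d ^ 2 + 18 * a * b * c * d"

text \<open>The action may equally be divided by the determinant: minus the identity sends \<open>F\<close> to \<open>-F\<close>,
  so the orbits are the same.\<close>

definition gl2_equiv :: "cubic_form \<Rightarrow> cubic_form \<Rightarrow> bool" where
  "gl2_equiv F G \<longleftrightarrow>
     (\<exists>p q r s :: int. \<bar>p * s - q * r\<bar> = 1 \<and>
        (\<forall>x y :: int. cubic_eval G x y = cubic_eval F (p * x + q * y) (r * x + s * y)))"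

definition delone_faddeev_form :: "'a::field_char_0 set \<Rightarrow> cubic_form \<Rightarrow> bool" where
  "delone_faddeev_form K F \<longleftrightarrow> (case F of (a, b, c, d) \<Rightarrow>
     has_discriminant K (cubic_disc F) \<and>
     (\<exists>\<theta>\<in>K. cubic_eval F \<theta> 1 = 0) \<and>
     (\<forall>\<theta>\<in>K. cubic_eval F \<theta> 1 = 0 \<longrightarrow>
        rat_adjoin \<theta> = K \<and>
        int_basis [1, - of_int a * \<theta>, of_int d / \<theta>] (ring_of_integers K)))"

definition in_delone_faddeev_class :: "'a::field_char_0 set \<Rightarrow> cubic_form \<Rightarrow> bool" where
  "in_delone_faddeev_class K F \<longleftrightarrow>
     (\<exists>F\<^sub>0. delone_faddeev_form K F\<^sub>0 \<and> gl2_equiv F\<^sub>0 F)"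


section \<open>Binary quadratic forms and the narrow class group\<close>

type_synonym quad_form = "int \<times> int \<times> int"

fun quad_eval :: "quad_form \<Rightarrow> int \<Rightarrow> int \<Rightarrow> int" where
  "quad_eval (A, B, C) x y = A * x ^ 2 + B * x * y + C * y ^ 2"

fun quad_disc :: "quad_form \<Rightarrow> int" where
  "quad_disc (A, B, C) = B ^ 2 - 4 * A * C"

fun quad_primitive :: "quad_form \<Rightarrow> bool" where
  "quad_primitive (A, B, C) \<longleftrightarrow> gcd A (gcd B C) = 1"

definition quad_pos_def :: "quad_form \<Rightarrow> bool" where
  "quad_pos_def f \<longleftrightarrow> (\<forall>x y. (x, y) \<noteq> (0, 0) \<longrightarrow> quad_eval f x y > 0)"

fun hessian :: "cubic_form \<Rightarrow> quad_form" where
  "hessian (a, b, c, d) = (b ^ 2 - 3 * a * c, b * c - 9 * a * d, c ^ 2 - 3 * b * d)"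

text \<open>The integral form representing \<open>x \<mapsto> tr (x\<^sup>2) / 2\<close> in the ordered basis \<open>u, v\<close>.\<close>

definition half_trace_form :: "'a::field_char_0 set \<Rightarrow> 'a \<Rightarrow> 'a \<Rightarrow> quad_form \<Rightarrow> bool" where
  "half_trace_form K u v q \<longleftrightarrow>
     (\<forall>x y :: int. field_trace K ((of_int x * u + of_int y * v) ^ 2) / 2
                   = of_int (quad_eval q x y))"

text \<open>For negative discriminants the classes of the narrow class group are those of positive
  definite forms.\<close>

definition forms_of_disc :: "int \<Rightarrow> quad_form set" where
  "forms_of_disc \<Delta> =
     {f. quad_primitive f \<and> quad_disc f = \<Delta> \<and> (\<Delta> < 0 \<longrightarrow> quad_pos_def f)}"

definition sl2_rel :: "int \<Rightarrow> quad_form rel" where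
  "sl2_rel \<Delta> = {(f, g). f \<in> forms_of_disc \<Delta> \<and> g \<in> forms_of_disc \<Delta> \<and>
     (\<exists>p q r s :: int. p * s - q * r = 1 \<and>
        (\<forall>x y. quad_eval g x y = quad_eval f (p * x + q * y) (r * x + s * y)))}"

definition form_class :: "int \<Rightarrow> quad_form \<Rightarrow> quad_form set" where
  "form_class \<Delta> f = sl2_rel \<Delta> `` {f}"

text \<open>Gauss: \<open>h\<close> is directly composed of \<open>f\<close> and \<open>g\<close>.  The sign conditions on the two minors
  make the composition direct; without them \<open>f\<close> or \<open>g\<close> could be replaced by its opposite.\<close>

definition direct_composition :: "quad_form \<Rightarrow> quad_form \<Rightarrow> quad_form \<Rightarrow> bool" where
  "direct_composition f g h \<longleftrightarrow>
     (\<exists>p\<^sub>0 p\<^sub>1 p\<^sub>2 p\<^sub>3 q\<^sub>0 q\<^sub>1 q\<^sub>2 q\<^sub>3 :: int.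
        (\<forall>x y z w. quad_eval f x y * quad_eval g z w =
           quad_eval h (p\<^sub>0 * x * z + p\<^sub>1 * x * w + p\<^sub>2 * y * z + p\<^sub>3 * y * w)
                       (q\<^sub>0 * x * z + q\<^sub>1 * x * w + q\<^sub>2 * y * z + q\<^sub>3 * y * w)) \<and>
        p\<^sub>0 * q\<^sub>1 - q\<^sub>0 * p\<^sub>1 = quad_eval f 1 0 \<and>
        p\<^sub>0 * q\<^sub>2 - q\<^sub>0 * p\<^sub>2 = quad_eval g 1 0)"

text \<open>By Gauss, for non-square \<open>\<Delta> \<equiv> 0, 1 (mod 4)\<close> all direct compositions of forms in
  two given classes make up exactly one class.  The unit is the class of \<open>(1, 0, -\<Delta>/4)\<close> or
  \<open>(1, 1, (1 - \<Delta>)/4)\<close>.\<close>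

definition narrow_class_group :: "int \<Rightarrow> quad_form set monoid" where
  "narrow_class_group \<Delta> =
     \<lparr>carrier = forms_of_disc \<Delta> // sl2_rel \<Delta>,
      monoid.mult = (\<lambda>X Y. {h \<in> forms_of_disc \<Delta>. \<exists>f\<in>X. \<exists>g\<in>Y. direct_composition f g h}),
      one = form_class \<Delta> (1, \<Delta> mod 2, (\<Delta> mod 2 - \<Delta>) div 4)\<rparr>"

end

theory Submission
  imports Defs
begin

text \<open>
  In the coordinates of \<open>\<alpha>\<^sub>0, \<beta>\<^sub>0\<close> half the trace form is \<open>H\<^sub>K / 3\<close>, and \<open>O\<^sub>K\<^sup>0\<close> is the
  sublattice of index 3 on which \<open>H\<^sub>K\<close> is divisible by 3. After an \<open>SL\<^sub>2\<close>-change of variables this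
  says \<open>H\<^sub>K = (3 A, B, C)\<close> and \<open>q\<^sub>K / 2 = (A, B, 3 C)\<close>, while \<open>C\<^bsub>d\<^esub>\<close> is equivalent to
  \<open>(3, B, A C)\<close>; these are the forms in Dirichlet's composition, so the product is always \<open>H\<^sub>K\<close>
  itself. That the class product is a single class comes from Gauss's argument: the minors of the bilinear
  substitution are determined by the two factors, and they determine it up to \<open>SL\<^sub>2(\<int>)\<close>.
  Fundamentality of \<open>d\<^sub>K\<close> enters only through primitivity: if \<open>d\<^sub>K = g\<^sup>2 E\<close> with
  \<open>E \<equiv> 0, 1 (mod 4)\<close>, then \<open>(E + \<surd>E) / 2\<close> is an integer of the quadratic field and generates a
  ring of discriminant \<open>E\<close>, which must be a square multiple of \<open>d\<^sub>K\<close>; hence \<open>g\<^sup>2 = 1\<close>.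
\<close>

text \<open>These module laws loop with \<open>of_int_mult\<close> and \<open>mult.assoc\<close>.\<close>

declare intmod.scale_scale [simp del] ratvs.scale_scale [simp del]

section \<open>Composition of binary quadratic forms\<close>

text \<open>Why the trace-zero lattice is the one on which the Hessian is divisible by 3: since -2 =
  1 modulo 3, the Hessian is congruent to the square of \<open>b x - c y\<close>, while
  \<open>k + m \<alpha> + n \<beta>\<close> has trace \<open>3 k + m b - n c\<close>. Both
  conditions on \<open>(m, n)\<close> therefore say that 3 divides \<open>m b - n c\<close>. As 3
  does not divide the discriminant, \<open>(b, c)\<close> is nonzero modulo 3 and so defines a point
  of the projective line over the field with 3 elements; its four points are the four cases for the
  basis.

  Two obstacles shape the proof. A product of classes is the set of all direct compositions of all
  representatives, so one explicit composition gives only one inclusion. And the Delone-Faddeev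
  basis is available for a single form of the class; for the given form it has to be carried along
  the Moebius map that relates the roots.

  The number 3 also supplies nondegeneracy: it divides \<open>-3 * D\<close> exactly once, so this
  is not a square and no form of that discriminant has leading coefficient 0.\<close>

lemma quad_eval_inject:
  assumes "\<And>x y. quad_eval f x y = quad_eval g x y"
  shows "f = g"
proof -
  obtain A B C A' B' C' where [simp]: "f = (A, B, C)" "g = (A', B', C')"
    by (metis prod_cases3)
  show ?thesis
    using assms[of 1 0] assms[of 0 1] assms[of 1 1] by simp
qed

fun quad_subst :: "quad_form \<Rightarrow> int \<Rightarrow> int \<Rightarrow> int \<Rightarrow> int \<Rightarrow> quad_form" where
  "quad_subst (A, B, C) p q r s =
     (A * p ^ 2 + B * p * r + C * r ^ 2,
      2 * A * p * q + B * (p * s + q * r) + 2 * C * r * s,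
      A * q ^ 2 + B * q * s + C * s ^ 2)"

lemma quad_eval_subst:
  "quad_eval (quad_subst f p q r s) x y = quad_eval f (p * x + q * y) (r * x + s * y)"
  by (cases f) (simp add: algebra_simps power2_eq_square)

lemma quad_disc_subst:
  "quad_disc (quad_subst f p q r s) = (p * s - q * r) ^ 2 * quad_disc f"
  by (cases f) (simp add: algebra_simps power2_eq_square)

lemma quad_disc_eq_if_eval:
  assumes "\<And>x y. quad_eval g x y = quad_eval f (p * x + q * y) (r * x + s * y)"
  shows "quad_disc g = (p * s - q * r) ^ 2 * quad_disc f"
proof -
  have "g = quad_subst f p q r s"
    by (rule quad_eval_inject) (simp add: quad_eval_subst assms)
  then show ?thesis by (simp add: quad_disc_subst)
qed

section \<open>Proper equivalence of forms\<close>

lemma sl2_rel_refl: "f \<in> forms_of_disc \<Delta> \<Longrightarrow> (f, f) \<in> sl2_rel \<Delta>"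
  unfolding sl2_rel_def
  by (simp, rule exI[of _ 1], rule exI[of _ 0], rule exI[of _ 0], rule exI[of _ 1]) simp

lemma sl2_rel_sym:
  assumes "(f, g) \<in> sl2_rel \<Delta>"
  shows "(g, f) \<in> sl2_rel \<Delta>"
proof -
  from assms obtain p q r s :: int where fg: "f \<in> forms_of_disc \<Delta>" "g \<in> forms_of_disc \<Delta>"
    and det: "p * s - q * r = 1"
    and e: "\<And>x y. quad_eval g x y = quad_eval f (p * x + q * y) (r * x + s * y)"
    unfolding sl2_rel_def by auto
  have "quad_eval f x y = quad_eval g (s * x + (- q) * y) ((- r) * x + p * y)" for x y
  proof -
    have "p * (s * x + (- q) * y) + q * ((- r) * x + p * y) = (p * s - q * r) * x"
      "r * (s * x + (- q) * y) + s * ((- r) * x + p * y) = (p * s - q * r) * y"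
      by (simp_all add: algebra_simps)
    then show ?thesis by (simp only: e det) simp
  qed
  moreover have "s * p - (- q) * (- r) = 1" using det by (simp add: algebra_simps)
  ultimately show ?thesis unfolding sl2_rel_def using fg by blast
qed

lemma sl2_rel_trans:
  assumes "(f, g) \<in> sl2_rel \<Delta>" "(g, h) \<in> sl2_rel \<Delta>"
  shows "(f, h) \<in> sl2_rel \<Delta>"
proof -
  from assms(1) obtain p q r s :: int where fg: "f \<in> forms_of_disc \<Delta>" "g \<in> forms_of_disc \<Delta>"
    and det: "p * s - q * r = 1"
    and e: "\<And>x y. quad_eval g x y = quad_eval f (p * x + q * y) (r * x + s * y)"
    unfolding sl2_rel_def by auto
  from assms(2) obtain p' q' r' s' :: int where h: "h \<in> forms_of_disc \<Delta>"
    and det': "p' * s' - q' * r' = 1"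
    and e': "\<And>x y. quad_eval h x y = quad_eval g (p' * x + q' * y) (r' * x + s' * y)"
    unfolding sl2_rel_def by auto
  have "quad_eval h x y = quad_eval f ((p * p' + q * r') * x + (p * q' + q * s') * y)
     ((r * p' + s * r') * x + (r * q' + s * s') * y)" for x y
    by (simp add: e e' algebra_simps)
  moreover have "(p * p' + q * r') * (r * q' + s * s') - (p * q' + q * s') * (r * p' + s * r')
      = (p * s - q * r) * (p' * s' - q' * r')"
    by (simp add: algebra_simps)
  ultimately show ?thesis unfolding sl2_rel_def using fg h det det' by force
qed

lemma form_class_eq:
  assumes "(f, g) \<in> sl2_rel \<Delta>"
  shows "form_class \<Delta> f = form_class \<Delta> g"
  unfolding form_class_def using assms sl2_rel_sym sl2_rel_trans by blast

lemma form_class_in_carrier: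
  "f \<in> forms_of_disc \<Delta> \<Longrightarrow> form_class \<Delta> f \<in> carrier (narrow_class_group \<Delta>)"
  by (simp add: narrow_class_group_def form_class_def quotientI)

section \<open>Bilinear substitutions and their minors\<close>

text \<open>Polynomials with equal squares agree up to sign, and the common nonzero leading
  coefficient fixes the sign. The argument works with a few integer values instead of
  polynomials.\<close>

lemma square_quad_form_eqD:
  fixes A B C A' B' C' :: int
  assumes sq: "\<And>x y. quad_eval (A', B', C') x y ^ 2 = quad_eval (A, B, C) x y ^ 2"
    and "A' = A" "A \<noteq> 0"
  shows "B' = B \<and> C' = C"
proof -
  have e: "(A + B' * y + C' * y\<^sup>2)\<^sup>2 = (A + B * y + C * y\<^sup>2)\<^sup>2" for y
    using sq[of 1 y] by (simp add: \<open>A' = A\<close>)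
  have e0: "C'\<^sup>2 = C\<^sup>2" using sq[of 0 1] by simp
  \<comment> \<open>Sum and difference of the values at \<open>y = 1\<close> and
    \<open>y = -1\<close> separate the terms of even degree in \<open>y\<close> from those of odd
    degree; the value at \<open>y = 2\<close> then separates \<open>A * B'\<close> from
    \<open>B' * C'\<close>.\<close>
  have 1: "2 * A * B' + 2 * A * C' + B'^2 + 2 * B' * C' = 2 * A * B + 2 * A * C + B^2 + 2 * B * C"
    using e[of 1] e0 by (simp add: power2_eq_square algebra_simps)
  have 2: "- 2 * A * B' + 2 * A * C' + B'^2 - 2 * B' * C' = - 2 * A * B + 2 * A * C + B^2 - 2 * B * C"
    using e[of "-1"] e0 by (simp add: power2_eq_square algebra_simps)
  have 3: "4 * A * B' + 8 * A * C' + 4 * B'^2 + 16 * B' * C' = 4 * A * B + 8 * A * C + 4 * B^2 + 16 * B * C"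
    using e[of 2] e0 by (simp add: power2_eq_square algebra_simps)
  have "A * B' = A * B" "2 * (A * C') + B'^2 = 2 * (A * C) + B^2"
    using 1 2 3 by (simp_all only: mult.assoc)
  then show ?thesis using \<open>A \<noteq> 0\<close> by auto
qed

text \<open>These are the Pluecker coordinates of the 2 by 4 matrix with rows \<open>P\<close> and
  \<open>Q\<close>; the columns 0 to 3 stand for the monomials \<open>xz\<close>, \<open>xw\<close>,
  \<open>yz\<close>, \<open>yw\<close>.\<close>

definition minor :: "(nat \<Rightarrow> int) \<Rightarrow> (nat \<Rightarrow> int) \<Rightarrow> nat \<Rightarrow> nat \<Rightarrow> int" where
  "minor P Q i j = P i * Q j - Q i * P j"

text \<open>The witnesses of \<open>direct_composition\<close> are exposed and indexed, so that
  statements about all minors can quantify over columns.\<close>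

definition composes ::
    "quad_form \<Rightarrow> quad_form \<Rightarrow> quad_form \<Rightarrow> (nat \<Rightarrow> int) \<Rightarrow> (nat \<Rightarrow> int) \<Rightarrow> bool" where
  "composes f g h P Q \<longleftrightarrow>
     (\<forall>x y z w. quad_eval f x y * quad_eval g z w =
        quad_eval h (P 0 * x * z + P 1 * x * w + P 2 * y * z + P 3 * y * w)
                    (Q 0 * x * z + Q 1 * x * w + Q 2 * y * z + Q 3 * y * w)) \<and>
     minor P Q 0 1 = quad_eval f 1 0 \<and> minor P Q 0 2 = quad_eval g 1 0"

definition vec4 :: "int \<Rightarrow> int \<Rightarrow> int \<Rightarrow> int \<Rightarrow> nat \<Rightarrow> int" where
  "vec4 a b c d k = (if k = 0 then a else if k = 1 then b else if k = 2 then c else d)"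

lemma vec4_simps [simp]:
  "vec4 a b c d 0 = a" "vec4 a b c d 1 = b" "vec4 a b c d (Suc 0) = b"
  "vec4 a b c d 2 = c" "vec4 a b c d 3 = d"
  by (simp_all add: vec4_def)

lemma direct_composition_iff_composes:
  "direct_composition f g h \<longleftrightarrow> (\<exists>P Q. composes f g h P Q)"
proof
  assume "direct_composition f g h"
  then obtain p0 p1 p2 p3 q0 q1 q2 q3 :: int where
    "\<forall>x y z w. quad_eval f x y * quad_eval g z w =
           quad_eval h (p0 * x * z + p1 * x * w + p2 * y * z + p3 * y * w)
                       (q0 * x * z + q1 * x * w + q2 * y * z + q3 * y * w)"
    "p0 * q1 - q0 * p1 = quad_eval f 1 0" "p0 * q2 - q0 * p2 = quad_eval g 1 0"
    unfolding direct_composition_def by blast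
  then have "composes f g h (vec4 p0 p1 p2 p3) (vec4 q0 q1 q2 q3)"
    by (simp add: composes_def minor_def)
  then show "\<exists>P Q. composes f g h P Q" by blast
next
  assume "\<exists>P Q. composes f g h P Q"
  then show "direct_composition f g h"
    unfolding composes_def minor_def direct_composition_def by blast
qed

text \<open>Exchanging the factors exchanges the monomials \<open>xw\<close> and \<open>yz\<close>,
  hence columns 1 and 2, and with them the two sign conditions.\<close>

lemma composes_commute:
  assumes "composes f g h P Q"
  shows "composes g f h (vec4 (P 0) (P 2) (P 1) (P 3)) (vec4 (Q 0) (Q 2) (Q 1) (Q 3))"
proof -
  have e: "quad_eval f x y * quad_eval g z w =
        quad_eval h (P 0 * x * z + P 1 * x * w + P 2 * y * z + P 3 * y * w)
                    (Q 0 * x * z + Q 1 * x * w + Q 2 * y * z + Q 3 * y * w)" for x y z w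
    using assms unfolding composes_def by blast
  have "quad_eval g x y * quad_eval f z w =
        quad_eval h (P 0 * x * z + P 2 * x * w + P 1 * y * z + P 3 * y * w)
                    (Q 0 * x * z + Q 2 * x * w + Q 1 * y * z + Q 3 * y * w)" for x y z w
    using e[of z w x y] by (simp add: algebra_simps)
  then show ?thesis using assms by (simp add: composes_def minor_def)
qed

text \<open>For fixed \<open>(x, y)\<close> the bilinear substitution is linear in \<open>(z, w)\<close>; its determinant is a
  quadratic form in \<open>(x, y)\<close> with the minors as coefficients. Comparing discriminants in \<open>(z, w)\<close>
  shows that its square is \<open>f\<^sup>2\<close>, and the sign condition makes it \<open>f\<close>.\<close>

lemma composes_minors_left:
  assumes comp: "composes (A, B, C) g h P Q"
    and disc: "quad_disc g = quad_disc h" "quad_disc h \<noteq> 0" and "A \<noteq> 0"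
  shows "minor P Q 0 3 - minor P Q 1 2 = B \<and> minor P Q 2 3 = C"
proof -
  obtain A2 B2 C2 where g: "g = (A2, B2, C2)" by (metis prod_cases3)
  have scale: "quad_disc (t * A2, t * B2, t * C2) = t ^ 2 * quad_disc (A2, B2, C2)" for t
    by (simp add: power2_eq_square algebra_simps)
  have "quad_eval (minor P Q 0 1, minor P Q 0 3 - minor P Q 1 2, minor P Q 2 3) x y ^ 2
      = quad_eval (A, B, C) x y ^ 2" for x y
  proof -
    let ?t = "quad_eval (A, B, C) x y"
    have "quad_eval (?t * A2, ?t * B2, ?t * C2) z w = ?t * quad_eval g z w" for z w
      by (simp only: g quad_eval.simps) (simp only: algebra_simps)
    also have "?t * quad_eval g z w = quad_eval h
        (P 0 * x * z + P 1 * x * w + P 2 * y * z + P 3 * y * w)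
        (Q 0 * x * z + Q 1 * x * w + Q 2 * y * z + Q 3 * y * w)" for z w
      using comp unfolding composes_def by blast
    finally have "quad_eval (?t * A2, ?t * B2, ?t * C2) z w = quad_eval h
        ((P 0 * x + P 2 * y) * z + (P 1 * x + P 3 * y) * w)
        ((Q 0 * x + Q 2 * y) * z + (Q 1 * x + Q 3 * y) * w)" for z w
      by (simp only: algebra_simps)
    from quad_disc_eq_if_eval[OF this]
    have "quad_disc (?t * A2, ?t * B2, ?t * C2) = ((P 0 * x + P 2 * y) * (Q 1 * x + Q 3 * y)
        - (P 1 * x + P 3 * y) * (Q 0 * x + Q 2 * y)) ^ 2 * quad_disc h" .
    also have "quad_disc (?t * A2, ?t * B2, ?t * C2) = ?t ^ 2 * quad_disc h"
      unfolding disc(1)[symmetric] g by (rule scale)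
    also have "(P 0 * x + P 2 * y) * (Q 1 * x + Q 3 * y) - (P 1 * x + P 3 * y) * (Q 0 * x + Q 2 * y)
       = quad_eval (minor P Q 0 1, minor P Q 0 3 - minor P Q 1 2, minor P Q 2 3) x y"
      by (simp add: minor_def algebra_simps power2_eq_square)
    finally show ?thesis using disc(2) by simp
  qed
  from square_quad_form_eqD[OF this] show ?thesis
    using comp \<open>A \<noteq> 0\<close> by (simp add: composes_def)
qed

text \<open>The right factor is reached through \<open>composes_commute\<close>: exchanging columns
  1 and 2 flips the sign of \<open>minor P Q 1 2\<close>, so \<open>B\<close> is the difference and
  \<open>B'\<close> the sum of the same two minors.\<close>

lemma composes_minors:
  assumes comp: "composes (A, B, C) (A', B', C') h P Q"
    and disc: "quad_disc (A, B, C) = quad_disc h" "quad_disc (A', B', C') = quad_disc h"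
      "quad_disc h \<noteq> 0" and nz: "A \<noteq> 0" "A' \<noteq> 0"
  shows "minor P Q 0 1 = A" "minor P Q 2 3 = C" "minor P Q 0 2 = A'" "minor P Q 1 3 = C'"
    "2 * minor P Q 0 3 = B + B'" "2 * minor P Q 1 2 = B' - B"
proof -
  have 1: "minor P Q 0 3 - minor P Q 1 2 = B \<and> minor P Q 2 3 = C"
    using composes_minors_left[OF comp disc(2,3) nz(1)] .
  have 2: "minor P Q 0 3 + minor P Q 1 2 = B' \<and> minor P Q 1 3 = C'"
    using composes_minors_left[OF composes_commute[OF comp] disc(1,3) nz(2)]
    by (simp add: minor_def algebra_simps)
  show "minor P Q 0 1 = A" "minor P Q 0 2 = A'" using comp by (simp_all add: composes_def)
  show "minor P Q 2 3 = C" "minor P Q 1 3 = C'" using 1 2 by simp_all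
  show "2 * minor P Q 0 3 = B + B'" "2 * minor P Q 1 2 = B' - B" using 1 2 by linarith+
qed

text \<open>Cramer's rule expresses the left factor through the minors, which are coprime, so it is
  integral.\<close>

lemma same_minors_imp_left_factor:
  assumes m: "\<And>i j. i \<le> 3 \<Longrightarrow> j \<le> 3 \<Longrightarrow> minor P' Q' i j = minor P Q i j"
    and unit: "u * minor P Q 0 1 + v * (minor P Q 0 3 - minor P Q 1 2) + w * minor P Q 2 3 = 1"
  obtains p q r s :: int where
    "\<And>k. k \<le> 3 \<Longrightarrow> P' k = p * P k + q * Q k" "\<And>k. k \<le> 3 \<Longrightarrow> Q' k = r * P k + s * Q k"
proof -
  \<comment> \<open>An alternating pairing of row vectors for which \<open>L P Q\<close> is the left
    side of \<open>unit\<close>, that is 1. If \<open>X\<close> is a combination of \<open>P\<close>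
    and \<open>Q\<close>, its coefficients must then be \<open>L X Q\<close> and
    \<open>- L X P\<close>.\<close>
  define L where "L X Y = u * (X 0 * Y 1 - X 1 * Y 0)
    + v * ((X 0 * Y 3 - X 3 * Y 0) - (X 1 * Y 2 - X 2 * Y 1)) + w * (X 2 * Y 3 - X 3 * Y 2)"
    for X Y :: "nat \<Rightarrow> int"
  have L: "L X Q * P k - L X P * Q k = X k" if X: "X = P' \<or> X = Q'" and k: "k \<le> 3" for X k
  proof -
    \<comment> \<open>The 3 by 3 determinant on columns \<open>i\<close>, \<open>k\<close>,
      \<open>j\<close> with rows \<open>X\<close>, \<open>P'\<close>, \<open>Q'\<close> has a
      repeated row, hence vanishes; its expansion along \<open>X\<close> involves only minors, where
      \<open>P'\<close>, \<open>Q'\<close> may be replaced by \<open>P\<close>,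
      \<open>Q\<close>.\<close>
    have e: "X i * minor P Q k j + X j * minor P Q i k = X k * minor P Q i j"
      if "i \<le> 3" "j \<le> 3" for i j
      using X unfolding m[OF k \<open>j \<le> 3\<close>, symmetric] m[OF \<open>i \<le> 3\<close> k, symmetric] m[OF that, symmetric]
      by (auto simp: minor_def algebra_simps)
    have le: "(0::nat) \<le> 3" "(1::nat) \<le> 3" "(2::nat) \<le> 3" "(3::nat) \<le> 3" by simp_all
    have "L X Q * P k - L X P * Q k
      = u * (X 0 * minor P Q k 1 + X 1 * minor P Q 0 k)
      + v * ((X 0 * minor P Q k 3 + X 3 * minor P Q 0 k) - (X 1 * minor P Q k 2 + X 2 * minor P Q 1 k))
      + w * (X 2 * minor P Q k 3 + X 3 * minor P Q 2 k)"
      by (simp add: L_def minor_def algebra_simps)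
    also have "\<dots> = X k * (u * minor P Q 0 1 + v * (minor P Q 0 3 - minor P Q 1 2)
        + w * minor P Q 2 3)"
      unfolding e[OF le(1) le(2)] e[OF le(1) le(4)] e[OF le(2) le(3)] e[OF le(3) le(4)]
      by (simp only: algebra_simps)
    finally show ?thesis using unit by simp
  qed
  show thesis
    by (rule that[of "L P' Q" "- L P' P" "L Q' Q" "- L Q' P"]) (simp_all add: L)
qed

lemma le_3_cases:
  fixes k :: nat
  assumes "k \<le> 3"
  obtains "k = 0" | "k = 1" | "k = 2" | "k = 3"
  using assms by linarith

lemma quad_primitive_bezout:
  assumes "quad_primitive (A, B, C)"
  obtains u v w where "u * A + v * B + w * C = 1"
proof -
  obtain u t where 1: "u * A + t * gcd B C = 1"
    using assms bezout_int[of A "gcd B C"] by auto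
  obtain v w where 2: "v * B + w * C = gcd B C" using bezout_int by blast
  have "u * A + (t * v) * B + (t * w) * C = u * A + t * (v * B + w * C)"
    by (simp add: algebra_simps)
  then have "u * A + (t * v) * B + (t * w) * C = 1" using 1 2 by simp
  then show thesis using that by blast
qed

text \<open>The image of the linear map contains all multiples of its determinant, by the adjugate
  matrix, and homogeneity recovers a quadratic form from its values there.\<close>

lemma quad_eval_linear_inject:
  assumes e: "\<And>z w. quad_eval f (a * z + b * w) (c * z + d * w) = quad_eval g (a * z + b * w) (c * z + d * w)"
    and det: "a * d - b * c \<noteq> 0"
  shows "f = g"
proof (rule quad_eval_inject)
  fix x y
  let ?m = "a * d - b * c"
  have scale: "quad_eval k (t * x) (t * y) = t ^ 2 * quad_eval k x y" for k t
    by (cases k) (simp add: power2_eq_square algebra_simps)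
  have "quad_eval f (?m * x) (?m * y) = quad_eval g (?m * x) (?m * y)"
    using e[of "d * x - b * y" "a * y - c * x"] by (simp add: algebra_simps)
  then show "quad_eval f x y = quad_eval g x y" using det by (simp add: scale)
qed

section \<open>Uniqueness and class invariance of direct composition\<close>

text \<open>Both substitutions have the same minors, so the rows of one are integral combinations of
  the rows of the other; a common nonzero minor forces the transition matrix to have determinant 1.
  That matrix is the proper equivalence sought.\<close>

theorem composition_unique:
  assumes f: "f \<in> forms_of_disc \<Delta>" and g: "g \<in> forms_of_disc \<Delta>"
    and h: "h \<in> forms_of_disc \<Delta>" "h' \<in> forms_of_disc \<Delta>"
    and nz: "quad_eval f 1 0 \<noteq> 0" "quad_eval g 1 0 \<noteq> 0" "\<Delta> \<noteq> 0"
    and comp: "direct_composition f g h" "direct_composition f g h'"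
  shows "(h, h') \<in> sl2_rel \<Delta>"
proof -
  obtain A B C A2 B2 C2 where fg: "f = (A, B, C)" "g = (A2, B2, C2)" by (metis prod_cases3)
  obtain P Q P' Q' where c: "composes f g h P Q" "composes f g h' P' Q'"
    using comp unfolding direct_composition_iff_composes by blast
  have d: "quad_disc f = \<Delta>" "quad_disc g = \<Delta>" "quad_disc h = \<Delta>" "quad_disc h' = \<Delta>"
    using f g h by (auto simp: forms_of_disc_def)
  have A: "A \<noteq> 0" "A2 \<noteq> 0" using nz by (simp_all add: fg)
  note m = composes_minors[OF c(1)[unfolded fg], folded fg, unfolded d, OF refl refl nz(3) A]
  note m' = composes_minors[OF c(2)[unfolded fg], folded fg, unfolded d, OF refl refl nz(3) A]
  have anti: "minor X Y i j = - minor X Y j i" for X Y i j by (simp add: minor_def)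
  have diag: "minor X Y i i = 0" for X Y i by (simp add: minor_def)
  have upper: "minor P' Q' 0 1 = minor P Q 0 1" "minor P' Q' 0 2 = minor P Q 0 2"
    "minor P' Q' 0 3 = minor P Q 0 3" "minor P' Q' 1 2 = minor P Q 1 2"
    "minor P' Q' 1 3 = minor P Q 1 3" "minor P' Q' 2 3 = minor P Q 2 3"
    using m m' by linarith+
  then have lower: "minor P' Q' 1 0 = minor P Q 1 0" "minor P' Q' 2 0 = minor P Q 2 0"
    "minor P' Q' 3 0 = minor P Q 3 0" "minor P' Q' 2 1 = minor P Q 2 1"
    "minor P' Q' 3 1 = minor P Q 3 1" "minor P' Q' 3 2 = minor P Q 3 2"
    by (metis anti)+
  have same: "minor P' Q' i j = minor P Q i j" if "i \<le> 3" "j \<le> 3" for i j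
    by (rule le_3_cases[OF that(1)]; rule le_3_cases[OF that(2)])
       (simp_all only: upper lower diag)
  have "quad_primitive (A, B, C)" using f by (simp add: forms_of_disc_def fg)
  \<comment> \<open>This is where primitivity of \<open>f\<close> enters: \<open>A\<close>,
    \<open>B\<close>, \<open>C\<close> are integral combinations of the minors, so the minors are
    coprime.\<close>
  then obtain u v w where "u * A + v * B + w * C = 1" by (rule quad_primitive_bezout)
  moreover have m03_12: "minor P Q 0 3 - minor P Q 1 2 = B" using m(5,6) by linarith
  ultimately have "u * minor P Q 0 1 + v * (minor P Q 0 3 - minor P Q 1 2) + w * minor P Q 2 3 = 1"
    using m(1,2) m03_12 by simp
  then obtain p q r s where T: "\<And>k. k \<le> 3 \<Longrightarrow> P' k = p * P k + q * Q k"
    "\<And>k. k \<le> 3 \<Longrightarrow> Q' k = r * P k + s * Q k"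
    using same_minors_imp_left_factor[OF same] by blast
  have m01: "minor P Q 0 1 \<noteq> 0" using m(1) A by simp
  have "minor P' Q' 0 1 = (p * s - q * r) * minor P Q 0 1"
    using T[of 0] T[of 1] by (simp add: minor_def algebra_simps)
  then have det: "p * s - q * r = 1" using upper(1) m01 by simp
  \<comment> \<open>For \<open>x = 1\<close>, \<open>y = 0\<close> the bilinear substitution becomes
    linear in \<open>(z, w)\<close> with determinant \<open>A\<close>, which is nonzero; this slice
    is enough to compare the two forms.\<close>
  have "h = quad_subst h' p q r s"
  proof (rule quad_eval_linear_inject)
    fix z w
    have "quad_eval h (P 0 * z + P 1 * w) (Q 0 * z + Q 1 * w) = quad_eval f 1 0 * quad_eval g z w"
    proof -
      from c(1) have "quad_eval f 1 0 * quad_eval g z w =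
        quad_eval h (P 0 * 1 * z + P 1 * 1 * w + P 2 * 0 * z + P 3 * 0 * w)
                    (Q 0 * 1 * z + Q 1 * 1 * w + Q 2 * 0 * z + Q 3 * 0 * w)"
        unfolding composes_def by blast
      then show ?thesis by simp
    qed
    also have "\<dots> = quad_eval h' (P' 0 * z + P' 1 * w) (Q' 0 * z + Q' 1 * w)"
    proof -
      from c(2) have "quad_eval f 1 0 * quad_eval g z w =
        quad_eval h' (P' 0 * 1 * z + P' 1 * 1 * w + P' 2 * 0 * z + P' 3 * 0 * w)
                    (Q' 0 * 1 * z + Q' 1 * 1 * w + Q' 2 * 0 * z + Q' 3 * 0 * w)"
        unfolding composes_def by blast
      then show ?thesis by simp
    qed
    also have "\<dots> = quad_eval (quad_subst h' p q r s) (P 0 * z + P 1 * w) (Q 0 * z + Q 1 * w)"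
      using T[of 0] T[of 1] by (simp add: quad_eval_subst algebra_simps)
    finally show "quad_eval h (P 0 * z + P 1 * w) (Q 0 * z + Q 1 * w) = \<dots>" .
  next
    show "P 0 * Q 1 - P 1 * Q 0 \<noteq> 0" using m01 by (simp add: minor_def algebra_simps)
  qed
  then have "(h', h) \<in> sl2_rel \<Delta>"
    unfolding sl2_rel_def using h det by (auto simp: quad_eval_subst)
  then show ?thesis by (rule sl2_rel_sym)
qed

lemma direct_composition_commute:
  "direct_composition f g h \<Longrightarrow> direct_composition g f h"
  unfolding direct_composition_iff_composes using composes_commute by blast

text \<open>A substitution in \<open>(x, y)\<close> transforms the three minor combinations with
  values \<open>A\<close>, \<open>B\<close>, \<open>C\<close> exactly like the coefficients of
  \<open>f\<close>. Hence the first sign condition for \<open>f'\<close> needs all of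
  \<open>composes_minors_left\<close>, while the second is only multiplied by the determinant
  1.\<close>

lemma direct_composition_equiv_left:
  assumes comp: "direct_composition f g h" and ff': "(f, f') \<in> sl2_rel \<Delta>"
    and disc: "quad_disc g = quad_disc h" "quad_disc h \<noteq> 0" "quad_eval f 1 0 \<noteq> 0"
  shows "direct_composition f' g h"
proof -
  from ff' obtain p q r s :: int where det: "p * s - q * r = 1"
    and e: "\<And>x y. quad_eval f' x y = quad_eval f (p * x + q * y) (r * x + s * y)"
    unfolding sl2_rel_def by auto
  obtain A B C where f: "f = (A, B, C)" by (metis prod_cases3)
  obtain P Q where c: "composes f g h P Q"
    using comp unfolding direct_composition_iff_composes by blast
  have m: "minor P Q 0 3 - minor P Q 1 2 = B \<and> minor P Q 2 3 = C"
    using composes_minors_left[OF c[unfolded f] disc(1,2)] disc(3) by (simp add: f)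
  have m0: "minor P Q 0 1 = A" "minor P Q 0 2 = quad_eval g 1 0"
    using c by (simp_all add: f composes_def)
  define V where "V X = vec4 (p * X 0 + r * X 2) (p * X 1 + r * X 3) (q * X 0 + s * X 2) (q * X 1 + s * X 3)"
    for X :: "nat \<Rightarrow> int"
  have "quad_eval f' x y * quad_eval g z w =
        quad_eval h (V P 0 * x * z + V P 1 * x * w + V P 2 * y * z + V P 3 * y * w)
                    (V Q 0 * x * z + V Q 1 * x * w + V Q 2 * y * z + V Q 3 * y * w)" for x y z w
  proof -
    have "quad_eval f (p * x + q * y) (r * x + s * y) * quad_eval g z w =
        quad_eval h (P 0 * (p * x + q * y) * z + P 1 * (p * x + q * y) * w
                       + P 2 * (r * x + s * y) * z + P 3 * (r * x + s * y) * w)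
                    (Q 0 * (p * x + q * y) * z + Q 1 * (p * x + q * y) * w
                       + Q 2 * (r * x + s * y) * z + Q 3 * (r * x + s * y) * w)"
      using c unfolding composes_def by blast
    then show ?thesis by (simp add: e V_def algebra_simps)
  qed
  moreover have "minor (V P) (V Q) 0 1 = quad_eval f' 1 0"
  proof -
    have "minor (V P) (V Q) 0 1 = minor P Q 0 1 * p ^ 2
        + (minor P Q 0 3 - minor P Q 1 2) * p * r + minor P Q 2 3 * r ^ 2"
      by (simp add: V_def minor_def power2_eq_square algebra_simps)
    then show ?thesis using m m0 by (simp add: e f)
  qed
  moreover have "minor (V P) (V Q) 0 2 = quad_eval g 1 0"
  proof -
    have "minor (V P) (V Q) 0 2 = (p * s - q * r) * minor P Q 0 2"
      by (simp add: V_def minor_def algebra_simps)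
    then show ?thesis using det m0 by simp
  qed
  ultimately show ?thesis
    unfolding direct_composition_iff_composes composes_def by blast
qed

text \<open>Changing the variables of \<open>h\<close> mixes the two rows \<open>P\<close> and
  \<open>Q\<close> by a matrix of determinant 1, which preserves every minor.\<close>

lemma direct_composition_equiv_result:
  assumes comp: "direct_composition f g h" and hh': "(h, h') \<in> sl2_rel \<Delta>"
  shows "direct_composition f g h'"
proof -
  from sl2_rel_sym[OF hh'] obtain p q r s :: int where det: "p * s - q * r = 1"
    and e: "\<And>x y. quad_eval h x y = quad_eval h' (p * x + q * y) (r * x + s * y)"
    unfolding sl2_rel_def by auto
  obtain P Q where c: "composes f g h P Q"
    using comp unfolding direct_composition_iff_composes by blast
  define P' where "P' k = p * P k + q * Q k" for k
  define Q' where "Q' k = r * P k + s * Q k" for k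
  have "minor P' Q' i j = (p * s - q * r) * minor P Q i j" for i j
    by (simp add: P'_def Q'_def minor_def algebra_simps)
  then have "minor P' Q' i j = minor P Q i j" for i j by (simp add: det)
  moreover have "quad_eval f x y * quad_eval g z w =
        quad_eval h' (P' 0 * x * z + P' 1 * x * w + P' 2 * y * z + P' 3 * y * w)
                     (Q' 0 * x * z + Q' 1 * x * w + Q' 2 * y * z + Q' 3 * y * w)" for x y z w
  proof -
    have "quad_eval f x y * quad_eval g z w =
        quad_eval h (P 0 * x * z + P 1 * x * w + P 2 * y * z + P 3 * y * w)
                     (Q 0 * x * z + Q 1 * x * w + Q 2 * y * z + Q 3 * y * w)"
      using c unfolding composes_def by blast
    then show ?thesis by (simp add: e P'_def Q'_def algebra_simps)
  qed
  ultimately have "composes f g h' P' Q'"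
    using c unfolding composes_def by simp
  then show ?thesis unfolding direct_composition_iff_composes by blast
qed

text \<open>Any composition of other representatives can be moved back to one of \<open>f\<close>
  and \<open>g\<close> themselves, the second factor by commuting, and is then equivalent to
  \<open>h\<close> by \<open>composition_unique\<close>.\<close>

theorem form_class_mult:
  assumes fgh: "f \<in> forms_of_disc \<Delta>" "g \<in> forms_of_disc \<Delta>" "h \<in> forms_of_disc \<Delta>"
    and comp: "direct_composition f g h"
    and nonsquare: "\<And>n. n ^ 2 \<noteq> \<Delta>"
  shows "form_class \<Delta> f \<otimes>\<^bsub>narrow_class_group \<Delta>\<^esub> form_class \<Delta> g = form_class \<Delta> h"
proof -
  have "\<Delta> \<noteq> 0" using nonsquare[of 0] by auto
  have disc: "quad_disc k = \<Delta>" if "k \<in> forms_of_disc \<Delta>" for k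
    using that by (simp add: forms_of_disc_def)
  \<comment> \<open>A form with leading coefficient 0 would have the square of its middle
    coefficient as discriminant.\<close>
  have nz: "quad_eval k 1 0 \<noteq> 0" if "k \<in> forms_of_disc \<Delta>" for k
    using disc[OF that] nonsquare[of "fst (snd k)"] by (cases k) auto
  have left: "direct_composition f2 g2 h2"
    if "direct_composition f1 g2 h2" "(f1, f2) \<in> sl2_rel \<Delta>" "g2 \<in> forms_of_disc \<Delta>" "h2 \<in> forms_of_disc \<Delta>"
    for f1 f2 g2 h2
  proof -
    have "f1 \<in> forms_of_disc \<Delta>" using that(2) by (auto simp: sl2_rel_def)
    then show ?thesis
      using direct_composition_equiv_left[OF that(1,2)] disc nz that \<open>\<Delta> \<noteq> 0\<close> by metis
  qed
  have "(h, h2) \<in> sl2_rel \<Delta>"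
    if h2: "h2 \<in> forms_of_disc \<Delta>" and ff2: "(f, f2) \<in> sl2_rel \<Delta>" and gg2: "(g, g2) \<in> sl2_rel \<Delta>"
      and c: "direct_composition f2 g2 h2" for f2 g2 h2
  proof -
    have "g2 \<in> forms_of_disc \<Delta>" using gg2 by (auto simp: sl2_rel_def)
    then have "direct_composition f g2 h2" using left[OF c sl2_rel_sym[OF ff2]] h2 by blast
    then have "direct_composition g2 f h2" by (rule direct_composition_commute)
    then have "direct_composition g f h2" using left sl2_rel_sym[OF gg2] fgh h2 by blast
    then have "direct_composition f g h2" by (rule direct_composition_commute)
    then show ?thesis
      using composition_unique fgh h2 nz \<open>\<Delta> \<noteq> 0\<close> comp by blast
  qed
  moreover have "h2 \<in> forms_of_disc \<Delta> \<and> (f, f) \<in> sl2_rel \<Delta> \<and> (g, g) \<in> sl2_rel \<Delta> \<and> direct_composition f g h2"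
    if "(h, h2) \<in> sl2_rel \<Delta>" for h2
    using that fgh sl2_rel_refl direct_composition_equiv_result[OF comp that]
    by (auto simp: sl2_rel_def)
  ultimately show ?thesis
    by (fastforce simp: narrow_class_group_def form_class_def)
qed

text \<open>Let \<open>w\<^sup>2 = B w - A\<^sub>1 A\<^sub>2 C\<close>. The norm of
  \<open>A\<^sub>1 x + w y\<close> is \<open>A\<^sub>1\<close> times the first form, and similarly
  for the second; multiplying out \<open>(A\<^sub>1 x + w y) (A\<^sub>2 z + w t)\<close> gives
  \<open>A\<^sub>1 A\<^sub>2 (x z - C y t) + w (A\<^sub>1 x t + A\<^sub>2 y z + B y t)\<close>, from
  which the witnesses are read off.\<close>

lemma dirichlet_composition:
  "direct_composition (A\<^sub>1, B, A\<^sub>2 * C) (A\<^sub>2, B, A\<^sub>1 * C) (A\<^sub>1 * A\<^sub>2, B, C)"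
proof -
  have "composes (A\<^sub>1, B, A\<^sub>2 * C) (A\<^sub>2, B, A\<^sub>1 * C) (A\<^sub>1 * A\<^sub>2, B, C)
    (vec4 1 0 0 (- C)) (vec4 0 A\<^sub>1 A\<^sub>2 B)"
    by (simp add: composes_def minor_def power2_eq_square algebra_simps)
  then show ?thesis unfolding direct_composition_iff_composes by blast
qed

section \<open>Fields and bases over the rationals\<close>

lemma det_2_mat:
  fixes f :: "nat \<times> nat \<Rightarrow> 'a::comm_ring_1"
  shows "Determinant.det (mat 2 2 f) = f (0,0) * f (1,1) - f (0,1) * f (1,0)"
  apply (subst laplace_expansion_row[of _ 2 0])
  apply (simp_all add: numeral_2_eq_2 cofactor_def mat_delete_def det_single)
  done
lemma det_3_mat:
  fixes f :: "nat \<times> nat \<Rightarrow> 'a::comm_ring_1"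
  shows "Determinant.det (mat 3 3 f) = f (0,0) * (f (1,1) * f (2,2) - f (1,2) * f (2,1))
    - f (0,1) * (f (1,0) * f (2,2) - f (1,2) * f (2,0)) + f (0,2) * (f (1,0) * f (2,1) - f (1,1) * f (2,0))"
  apply (subst laplace_expansion_row[of _ 3 0])
  apply (simp_all add: numeral_3_eq_3 cofactor_def mat_delete_def det_2_mat[unfolded numeral_2_eq_2])
  apply (simp add: numeral_2_eq_2 algebra_simps)
  done

lemma subfield_closed:
  assumes "is_subfield K"
  shows subfield_0: "0 \<in> K" and subfield_1: "1 \<in> K"
    and subfield_uminus: "x \<in> K \<Longrightarrow> - x \<in> K"
    and subfield_diff: "x \<in> K \<Longrightarrow> y \<in> K \<Longrightarrow> x - y \<in> K"
    and subfield_add: "x \<in> K \<Longrightarrow> y \<in> K \<Longrightarrow> x + y \<in> K"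
    and subfield_mult: "x \<in> K \<Longrightarrow> y \<in> K \<Longrightarrow> x * y \<in> K"
    and subfield_divide: "x \<in> K \<Longrightarrow> y \<in> K \<Longrightarrow> x / y \<in> K"
proof -
  note c = assms[unfolded is_subfield_def]
  show "1 \<in> K" using c by blast
  then show 0: "0 \<in> K" using c by (metis diff_self)
  then show u: "- x \<in> K" if "x \<in> K" for x using c that by (metis diff_0)
  show "x - y \<in> K" "x * y \<in> K" if "x \<in> K" "y \<in> K" for x y using c that by blast+
  show "x + y \<in> K" if "x \<in> K" "y \<in> K" for x y using c that u[of y] by (metis diff_minus_eq_add)
  show "x / y \<in> K" if "x \<in> K" "y \<in> K" for x y using c that by (metis divide_inverse)
qed

lemma subfield_of_rat:
  assumes "is_subfield K"
  shows "of_rat q \<in> K"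
proof -
  have nat: "of_nat n \<in> K" for n
    by (induction n) (simp_all add: subfield_closed[OF assms])
  have int: "of_int n \<in> K" for n
    by (cases n rule: int_cases2) (simp_all add: nat subfield_closed[OF assms])
  obtain a b where "quotient_of q = (a, b)" by (cases "quotient_of q") blast
  then have "q = of_int a / of_int b" by (rule quotient_of_div)
  then show ?thesis by (simp add: of_rat_divide subfield_closed[OF assms] int)
qed

lemma subfield_of_int: "is_subfield K \<Longrightarrow> of_int n \<in> K"
  using subfield_of_rat[of K "of_int n"] by simp

lemma subfield_subspace: "is_subfield K \<Longrightarrow> ratvs.subspace K"
  by (rule ratvs.subspaceI) (auto intro: subfield_closed subfield_of_rat)

text \<open>A rational relation times the product of its denominators is an integral one.\<close>

lemma int_independent_imp_rat_independent:
  assumes "intmod.independent S"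
  shows "ratvs.independent S"
  unfolding ratvs.independent_explicit_module
proof (intro allI impI)
  fix t u v
  assume t: "finite t" "t \<subseteq> S" "(\<Sum>v\<in>t. of_rat (u v) * v) = 0" "v \<in> t"
  define N where "N = (\<Prod>w\<in>t. snd (quotient_of (u w)))"
  have "N \<noteq> 0"
    unfolding N_def using t(1) by simp (metis less_irrefl quotient_of_denom_pos')
  have "\<exists>n. of_int N * u w = of_int n" if "w \<in> t" for w
  proof -
    obtain a b where ab: "quotient_of (u w) = (a, b)" by fastforce
    have "u w = of_int a / of_int b" "b \<noteq> 0"
      using quotient_of_div[OF ab] quotient_of_denom_pos[OF ab] by simp_all
    moreover have "b dvd N"
      unfolding N_def using dvd_prodI[OF t(1) that, of "\<lambda>w. snd (quotient_of (u w))"] ab by simp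
    then obtain k where "N = b * k" by (rule dvdE)
    ultimately have "of_int N * u w = of_int (k * a)" by simp
    then show ?thesis by blast
  qed
  then obtain n where n: "\<And>w. w \<in> t \<Longrightarrow> of_int N * u w = of_int (n w)" by metis
  have "(\<Sum>w\<in>t. of_int (n w) * w) = (\<Sum>w\<in>t. of_int N * (of_rat (u w) * w))"
  proof (rule sum.cong)
    fix w assume "w \<in> t"
    then have "(of_rat (of_int (n w)) :: 'a) = of_rat (of_int N * u w)" using n by simp
    then show "of_int (n w) * w = of_int N * (of_rat (u w) * w)" by (simp add: of_rat_mult)
  qed simp
  also have "\<dots> = 0" using t(3) by (simp flip: sum_distrib_left)
  finally have "n v = 0" using intmod.independentD[OF assms t(1,2) _ t(4)] by blast
  then show "u v = 0" using n[OF t(4)] \<open>N \<noteq> 0\<close> by simp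
qed

lemma int_span_le_rat_span: "intmod.span S \<subseteq> ratvs.span S"
proof (rule intmod.span_minimal)
  show "S \<subseteq> ratvs.span S" by (rule ratvs.span_superset)
  have "of_int c * x \<in> ratvs.span S" if "x \<in> ratvs.span S" for c x
    using ratvs.span_scale[OF that, of "of_int c"] by simp
  then show "intmod.subspace (ratvs.span S)"
    by (intro intmod.subspaceI) (auto intro: ratvs.span_zero ratvs.span_add)
qed

lemma rat_span_eq_if_card_eq_dim:
  assumes V: "ratvs.subspace V" and B: "ratvs.independent B" "B \<subseteq> V" "card B = ratvs.dim V"
    and "ratvs.dim V > 0"
  shows "ratvs.span B = V"
proof
  show "ratvs.span B \<subseteq> V" using V B by (simp add: ratvs.span_minimal)
  obtain B' where B': "V \<subseteq> ratvs.span B'" "card B' = ratvs.dim V"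
    using ratvs.basis_exists[of V] by metis
  \<comment> \<open>Positive dimension excludes infinite bases, because \<open>card\<close> of an
    infinite set is 0.\<close>
  have "finite B'" "finite B" using B' B assms(5) by (auto intro: card_ge_0_finite)
  show "V \<subseteq> ratvs.span B"
  proof
    fix x assume "x \<in> V"
    show "x \<in> ratvs.span B"
    proof (rule ccontr)
      assume x: "x \<notin> ratvs.span B"
      then have "ratvs.independent (insert x B)" using B by (simp add: ratvs.independent_insertI)
      moreover have "insert x B \<subseteq> ratvs.span B'" using B' B \<open>x \<in> V\<close> by blast
      ultimately have "card (insert x B) \<le> card B'"
        using ratvs.independent_span_bound[OF \<open>finite B'\<close>] by blast
      moreover have "x \<notin> B" using x ratvs.span_base by blast
      ultimately show False using \<open>finite B\<close> B B' by simp
    qed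
  qed
qed

lemma span_set_list:
  assumes "distinct ws"
  shows int_span_set_list: "intmod.span (set ws) = range (\<lambda>c. \<Sum>j<length ws. of_int (c j) * ws ! j)"
    and rat_span_set_list: "ratvs.span (set ws) = range (\<lambda>c. \<Sum>j<length ws. of_rat (c j) * ws ! j)"
proof -
  have bij: "bij_betw ((!) ws) {..<length ws} (set ws)"
    using assms by (simp add: bij_betw_nth)
  have e: "(\<Sum>v\<in>set ws. f v) = (\<Sum>j<length ws. f (ws ! j))" for f :: "'a \<Rightarrow> 'a"
    using sum.reindex_bij_betw[OF bij] by metis
  show "intmod.span (set ws) = range (\<lambda>c. \<Sum>j<length ws. of_int (c j) * ws ! j)"
  proof -
    define h where "h c v = c (the_inv_into {..<length ws} ((!) ws) v)" for c :: "nat \<Rightarrow> int" and v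
    have h: "h c (ws ! j) = c j" if "j < length ws" for j c
      using bij that by (simp add: h_def bij_betw_def the_inv_into_f_f)
    have "(\<Sum>j<length ws. of_int (c j) * ws ! j) = (\<Sum>v\<in>set ws. of_int (h c v) * v)" for c
      unfolding e by (simp add: h)
    then show ?thesis unfolding intmod.span_finite[OF finite_set] by (auto simp: e)
  qed
  show "ratvs.span (set ws) = range (\<lambda>c. \<Sum>j<length ws. of_rat (c j) * ws ! j)"
  proof -
    define h where "h c v = c (the_inv_into {..<length ws} ((!) ws) v)" for c :: "nat \<Rightarrow> rat" and v
    have h: "h c (ws ! j) = c j" if "j < length ws" for j c
      using bij that by (simp add: h_def bij_betw_def the_inv_into_f_f)
    have "(\<Sum>j<length ws. of_rat (c j) * ws ! j) = (\<Sum>v\<in>set ws. of_rat (h c v) * v)" for c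
      unfolding e by (simp add: h)
    then show ?thesis unfolding ratvs.span_finite[OF finite_set] by (auto simp: e)
  qed
qed

section \<open>The trace\<close>

text \<open>This is the identity tr(ST) = tr(TS): both traces expand into the same double sum, the
  base change from \<open>B\<close> to \<open>B'\<close> against the matrix that takes elements of
  \<open>B'\<close> to \<open>x\<close>-multiples written in \<open>B\<close>.\<close>

lemma trace_of_map_basis_change:
  assumes B: "ratvs.independent B" "finite B" and B': "ratvs.independent B'" "finite B'"
    and sp: "ratvs.span B' = ratvs.span B"
    and f: "\<And>b. b \<in> ratvs.span B \<Longrightarrow> x * b \<in> ratvs.span B"
  shows "(\<Sum>b\<in>B. ratvs.representation B (x * b) b) = (\<Sum>b\<in>B'. ratvs.representation B' (x * b) b)"
proof -
  let ?R = "ratvs.representation B" and ?R' = "ratvs.representation B'"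
  have mem: "b \<in> ratvs.span B" if "b \<in> B \<or> b \<in> B'" for b
    using that sp ratvs.span_base by blast
  have "?R (x * b) b = (\<Sum>c\<in>B'. ?R' b c * ?R (x * c) b)" if "b \<in> B" for b
  proof -
    have "b = (\<Sum>c\<in>B'. of_rat (?R' b c) * c)"
      using ratvs.sum_representation_eq[OF B'(1) _ B'(2), of b] sp mem that by simp
    then have "x * b = x * (\<Sum>c\<in>B'. of_rat (?R' b c) * c)" by (rule arg_cong)
    also have "\<dots> = (\<Sum>c\<in>B'. of_rat (?R' b c) * (x * c))"
      by (simp add: sum_distrib_left mult_ac)
    finally show ?thesis
      using f mem by (simp add: ratvs.representation_sum[OF B(1)] ratvs.representation_scale[OF B(1)]
          ratvs.span_scale)
  qed
  moreover have "?R' (x * c) c = (\<Sum>b\<in>B. ?R (x * c) b * ?R' b c)" if "c \<in> B'" for c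
  proof -
    have "x * c = (\<Sum>b\<in>B. of_rat (?R (x * c) b) * b)"
      using ratvs.sum_representation_eq[OF B(1) _ B(2), of "x * c"] f mem that by simp
    then have "?R' (x * c) c = ?R' (\<Sum>b\<in>B. of_rat (?R (x * c) b) * b) c" by simp
    also have "\<dots> = (\<Sum>b\<in>B. ?R (x * c) b * ?R' b c)"
      using mem sp by (simp add: ratvs.representation_sum[OF B'(1)] ratvs.representation_scale[OF B'(1)]
          ratvs.span_scale)
    finally show ?thesis .
  qed
  ultimately have "(\<Sum>b\<in>B. ?R (x * b) b) = (\<Sum>b\<in>B. \<Sum>c\<in>B'. ?R' b c * ?R (x * c) b)"
    "(\<Sum>b\<in>B'. ?R' (x * b) b) = (\<Sum>c\<in>B'. \<Sum>b\<in>B. ?R (x * c) b * ?R' b c)"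
    by simp_all
  moreover have "(\<Sum>b\<in>B. \<Sum>c\<in>B'. ?R' b c * ?R (x * c) b) = (\<Sum>c\<in>B'. \<Sum>b\<in>B. ?R (x * c) b * ?R' b c)"
    by (subst sum.swap) (intro sum.cong refl mult.commute)
  ultimately show ?thesis by (simp only:)
qed

text \<open>Frees the trace from the basis picked by \<open>SOME\<close>: the listed basis shows
  that a choice exists and is finite, and the diagonal may then be read in either basis.\<close>

lemma field_trace_eq_matrix_trace:
  assumes K: "is_subfield K" and ws: "distinct ws" "ratvs.independent (set ws)" "ratvs.span (set ws) = K"
    and x: "x \<in> K" "\<And>i. i < length ws \<Longrightarrow> x * ws ! i = (\<Sum>j<length ws. of_rat (A i j) * ws ! j)"
  shows "field_trace K x = (\<Sum>i<length ws. A i i)"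
proof -
  define B where "B = (SOME B. ratvs.independent B \<and> ratvs.span B = K)"
  have B: "ratvs.independent B \<and> ratvs.span B = K"
    unfolding B_def by (rule someI[of _ "set ws"]) (use ws in simp)
  then have "finite B" using ratvs.independent_span_bound[of "set ws" B] ws(3) B ratvs.span_superset[of B] finite_set by blast
  have "field_trace K x = (\<Sum>b\<in>B. ratvs.representation B (x * b) b)"
    by (simp only: field_trace_def B_def Let_def)
  also have "\<dots> = (\<Sum>b\<in>set ws. ratvs.representation (set ws) (x * b) b)"
    by (rule trace_of_map_basis_change[OF _ \<open>finite B\<close> ws(2) finite_set])
       (use B ws(3) x(1) subfield_mult[OF K] in blast)+
  also have "\<dots> = (\<Sum>i<length ws. ratvs.representation (set ws) (x * ws ! i) (ws ! i))"
    by (rule sum.reindex_bij_betw[OF bij_betw_nth[OF ws(1) refl refl], symmetric])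
  also have "\<dots> = (\<Sum>i<length ws. A i i)"
  proof (rule sum.cong)
    fix i assume "i \<in> {..<length ws}"
    then have i: "i < length ws" by simp
    have "ratvs.representation (set ws) (x * ws ! i) (ws ! i)
      = (\<Sum>j<length ws. A i j * (if ws ! i = ws ! j then 1 else 0))"
    proof -
      have mem: "ws ! j \<in> ratvs.span (set ws)" if "j < length ws" for j
        using that by (intro ratvs.span_base) simp
      have "ratvs.representation (set ws) (x * ws ! i)
        = (\<lambda>b. \<Sum>j<length ws. ratvs.representation (set ws) (of_rat (A i j) * ws ! j) b)"
        unfolding x(2)[OF i] by (rule ratvs.representation_sum[OF ws(2)]) (simp add: mem ratvs.span_scale)
      moreover have "ratvs.representation (set ws) (of_rat (A i j) * ws ! j) (ws ! i)
        = A i j * (if ws ! i = ws ! j then 1 else 0)" if "j < length ws" for j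
        using that by (simp add: ratvs.representation_scale[OF ws(2) mem] ratvs.representation_basis[OF ws(2)])
      ultimately show ?thesis by simp
    qed
    also have "\<dots> = (\<Sum>j<length ws. if i = j then A i j else 0)"
      using ws(1) i by (intro sum.cong) (auto simp: nth_eq_iff_index_eq)
    also have "\<dots> = A i i" using i by simp
    finally show "ratvs.representation (set ws) (x * ws ! i) (ws ! i) = A i i" .
  qed simp
  finally show ?thesis .
qed

lemma field_trace_linear:
  assumes K: "is_subfield K"
  shows field_trace_add: "x \<in> K \<Longrightarrow> y \<in> K \<Longrightarrow> field_trace K (x + y) = field_trace K x + field_trace K y"
    and field_trace_scale: "x \<in> K \<Longrightarrow> field_trace K (of_rat q * x) = q * field_trace K x"
proof -
  define B where "B = (SOME B. ratvs.independent B \<and> ratvs.span B = K)"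
  obtain B0 where "B0 \<subseteq> K" "ratvs.independent B0" "K \<subseteq> ratvs.span B0"
    using ratvs.basis_exists by metis
  then have "ratvs.independent B0 \<and> ratvs.span B0 = K"
    using ratvs.span_minimal[OF _ subfield_subspace[OF K]] by blast
  then have B: "ratvs.independent B" "ratvs.span B = K"
    unfolding B_def by (metis (mono_tags, lifting) someI_ex)+
  have e: "field_trace K x = (\<Sum>b\<in>B. ratvs.representation B (x * b) b)" for x
    by (simp only: field_trace_def B_def Let_def)
  have mem: "x * b \<in> ratvs.span B" if "x \<in> K" "b \<in> B" for x b
    using that subfield_mult[OF K] ratvs.span_base B by blast
  show "field_trace K (x + y) = field_trace K x + field_trace K y" if "x \<in> K" "y \<in> K"
    unfolding e using that mem
    by (simp add: distrib_right ratvs.representation_add[OF B(1)] sum.distrib)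
  show "field_trace K (of_rat q * x) = q * field_trace K x" if "x \<in> K"
    unfolding e using that mem
    by (simp add: mult.assoc ratvs.representation_scale[OF B(1)] sum_distrib_left)
qed

lemma field_trace_0: "is_subfield K \<Longrightarrow> field_trace K 0 = 0"
  using field_trace_scale[of K 0 0] subfield_0 by auto

lemma field_trace_sum:
  assumes K: "is_subfield K" and "finite I" and "\<And>i. i \<in> I \<Longrightarrow> f i \<in> K"
  shows "field_trace K (\<Sum>i\<in>I. f i) = (\<Sum>i\<in>I. field_trace K (f i))"
proof -
  have "(\<Sum>i\<in>I. f i) \<in> K \<and> ?thesis"
    using assms(2,3)
    by (induction rule: finite_induct)
       (auto simp: field_trace_0[OF K] field_trace_add[OF K] intro: subfield_closed[OF K])
  then show ?thesis ..
qed

section \<open>Integral bases and discriminants\<close>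

text \<open>The Gram matrix of \<open>vs\<close> is \<open>A * G * transpose_mat A\<close> by
  bilinearity of the trace pairing.\<close>

lemma gram_det_change:
  assumes K: "is_subfield K" and ws: "\<And>j. j < n \<Longrightarrow> ws ! j \<in> K"
    and vs: "\<And>i. i < n \<Longrightarrow> vs ! i = (\<Sum>j<n. of_rat (A i j) * ws ! j)"
  shows "Determinant.det (mat n n (\<lambda>(i, j). field_trace K (vs ! i * vs ! j)))
    = (Determinant.det (mat n n (\<lambda>(i, j). A i j))) ^ 2
      * Determinant.det (mat n n (\<lambda>(i, j). field_trace K (ws ! i * ws ! j)))"
proof -
  let ?A = "mat n n (\<lambda>(i, j). A i j)" and ?G = "mat n n (\<lambda>(i, j). field_trace K (ws ! i * ws ! j))"
  have "mat n n (\<lambda>(i, j). field_trace K (vs ! i * vs ! j)) = ?A * ?G * transpose_mat ?A"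
  proof (rule eq_matI)
    fix i j assume "i < dim_row (?A * ?G * transpose_mat ?A)" "j < dim_col (?A * ?G * transpose_mat ?A)"
    then have ij: "i < n" "j < n" by auto
    have mem: "ws ! k * ws ! l \<in> K" if "k < n" "l < n" for k l
      using that ws subfield_mult[OF K] by blast
    have memq: "of_rat q * (ws ! k * ws ! l) \<in> K" if "k < n" "l < n" for k l q
      using mem[OF that] subfield_mult[OF K] subfield_of_rat[OF K] by blast
    have "vs ! i * vs ! j = (\<Sum>l<n. \<Sum>k<n. of_rat (A i k * A j l) * (ws ! k * ws ! l))"
      unfolding vs[OF ij(1)] vs[OF ij(2)]
      by (subst sum.swap) (simp add: sum_product of_rat_mult mult_ac)
    then have "vs ! i * vs ! j = (\<Sum>(l, k)\<in>{..<n} \<times> {..<n}. of_rat (A i k * A j l) * (ws ! k * ws ! l))"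
      by (simp add: sum.cartesian_product)
    then have "field_trace K (vs ! i * vs ! j)
      = (\<Sum>(l, k)\<in>{..<n} \<times> {..<n}. field_trace K (of_rat (A i k * A j l) * (ws ! k * ws ! l)))"
      using memq by (simp only:) (auto simp: split_def intro!: field_trace_sum[OF K])
    also have "\<dots> = (\<Sum>l<n. \<Sum>k<n. A i k * A j l * field_trace K (ws ! k * ws ! l))"
      unfolding sum.cartesian_product[symmetric] using mem by (simp add: field_trace_scale[OF K])
    also have "\<dots> = (?A * ?G * transpose_mat ?A) $$ (i, j)"
      using ij by (simp add: scalar_prod_def sum_distrib_right sum_distrib_left atLeast0LessThan mult_ac)
    finally show "mat n n (\<lambda>(i, j). field_trace K (vs ! i * vs ! j)) $$ (i, j)
      = (?A * ?G * transpose_mat ?A) $$ (i, j)" using ij by simp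
  qed auto
  also have "Determinant.det (?A * ?G * transpose_mat ?A) = Determinant.det ?A * Determinant.det ?G * Determinant.det ?A"
    by (subst det_mult[of _ n], (auto)[2], subst det_mult[of _ n], (auto)[2])
       (simp add: det_transpose[of _ n])
  finally show ?thesis by (simp add: power2_eq_square)
qed

text \<open>The span hypothesis says that integers generate the field rationally. It is supplied
  from explicit integers, in the quadratic case \<open>1\<close> and a square root, in the cubic
  case the Delone-Faddeev basis.\<close>

lemma int_basis_imp_rat_basis:
  assumes K: "number_field_deg n K" and ws: "int_basis ws (ring_of_integers K)"
    and sp: "K \<subseteq> ratvs.span (ring_of_integers K)"
  shows "distinct ws" "ratvs.independent (set ws)" "ratvs.span (set ws) = K" "length ws = n"
proof -
  have sub: "ratvs.subspace K" "ratvs.dim K = n"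
    using K subfield_subspace by (auto simp: number_field_deg_def)
  show d: "distinct ws" and i: "ratvs.independent (set ws)"
    using ws int_independent_imp_rat_independent by (auto simp: int_basis_def)
  have O: "intmod.span (set ws) = ring_of_integers K" using ws by (simp add: int_basis_def)
  have "set ws \<subseteq> K"
    using O intmod.span_superset[of "set ws"] by (auto simp: ring_of_integers_def)
  moreover have "ring_of_integers K \<subseteq> ratvs.span (set ws)"
    using O int_span_le_rat_span by blast
  then have "K \<subseteq> ratvs.span (set ws)"
    using sp ratvs.span_mono ratvs.span_span by (metis subset_trans)
  ultimately show s: "ratvs.span (set ws) = K" using sub ratvs.span_minimal by blast
  then show "length ws = n"
    using ratvs.dim_span_eq_card_independent[OF i] d distinct_card sub by metis
qed

text \<open>Integers have integral coordinates in an integral basis, so the base change determinant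
  is an integer \<open>m\<close>. This yields both the minimality of fundamental discriminants and
  the uniqueness of the cubic discriminant.\<close>

lemma gram_det_eq_square_mult_discriminant:
  assumes K: "number_field_deg n K" and D: "has_discriminant K D"
    and sp: "K \<subseteq> ratvs.span (ring_of_integers K)"
    and vs: "length vs = n" "set vs \<subseteq> ring_of_integers K"
  shows "\<exists>m::int. Determinant.det (mat n n (\<lambda>(i, j). field_trace K (vs ! i * vs ! j)))
    = of_int (m ^ 2 * D)"
proof -
  have Ks: "is_subfield K" using K by (simp add: number_field_deg_def)
  obtain ws where ws: "int_basis ws (ring_of_integers K)" and
    D: "of_int D = Determinant.det (mat (length ws) (length ws) (\<lambda>(i, j). field_trace K (ws ! i * ws ! j)))"
    using D unfolding has_discriminant_def by blast
  note b = int_basis_imp_rat_basis[OF K ws sp]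
  have O: "intmod.span (set ws) = ring_of_integers K" using ws by (simp add: int_basis_def)
  have "set ws \<subseteq> K"
    using O intmod.span_superset[of "set ws"] by (auto simp: ring_of_integers_def)
  then have wsK: "ws ! j \<in> K" if "j < n" for j using b(4) that by auto
  have "\<exists>c. vs ! i = (\<Sum>j<n. of_int (c j) * ws ! j)" if "i < n" for i
  proof -
    have "vs ! i \<in> intmod.span (set ws)" using vs that unfolding O by auto
    then show ?thesis unfolding int_span_set_list[OF b(1)] b(4) by blast
  qed
  then obtain A where A: "\<And>i. i < n \<Longrightarrow> vs ! i = (\<Sum>j<n. of_int (A i j) * ws ! j)" by metis
  have "Determinant.det (mat n n (\<lambda>(i, j). field_trace K (vs ! i * vs ! j)))
    = (Determinant.det (mat n n (\<lambda>(i, j). of_int (A i j)))) ^ 2 * of_int D"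
    unfolding D b(4) by (rule gram_det_change[OF Ks wsK]) (simp_all add: A)
  also have "mat n n (\<lambda>(i, j). of_int (A i j)) = map_mat (of_int :: int \<Rightarrow> rat) (mat n n (\<lambda>(i, j). A i j))"
    by (rule eq_matI) auto
  finally show ?thesis by (auto simp: of_int_hom.hom_det)
qed

section \<open>Quadratic fields\<close>

lemma algebraic_int_if_quadratic:
  fixes x :: "'a::field_char_0"
  assumes "x ^ 2 = of_int t * x + of_int n"
  shows "algebraic_int x"
proof (rule algebraic_int.intros)
  let ?p = "[:of_int (- n), of_int (- t), 1:] :: 'a poly"
  show "lead_coeff ?p = 1" by simp
  show "\<forall>i. coeff ?p i \<in> \<int>"
    by (auto simp: coeff_pCons split: nat.split simp del: of_int_minus)
  show "poly ?p x = 0" using assms by (simp add: power2_eq_square algebra_simps)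
qed

lemma quadratic_field_generator:
  fixes L :: "'a::field_char_0 set"
  assumes "quadratic_field L"
  obtains z and N :: int where "z \<in> L" "z ^ 2 = of_int N" "z \<notin> \<rat>"
proof -
  have L: "is_subfield L" "ratvs.dim L = 2" using assms by (auto simp: number_field_deg_def)
  have sp1: "ratvs.span {1} = \<rat>" by (simp add: ratvs.span_singleton Rats_def)
  have "\<not> L \<subseteq> ratvs.span {1}" using ratvs.dim_le_card[of L "{1}"] L(2) by auto
  then obtain y where y: "y \<in> L" "y \<notin> \<rat>" unfolding sp1 by blast
  then have "y \<noteq> 1" by auto
  have ind: "ratvs.independent {y, 1}"
    using y by (intro ratvs.independent_insertI) (simp_all add: sp1 ratvs.independent_empty)
  have "ratvs.span (set [y, 1]) = L"
    using rat_span_eq_if_card_eq_dim[OF subfield_subspace[OF L(1)] ind] L y \<open>y \<noteq> 1\<close> subfield_1[OF L(1)]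
    by simp
  moreover have "y ^ 2 \<in> L" using y L subfield_mult by (auto simp: power2_eq_square)
  ultimately obtain c where "y ^ 2 = (\<Sum>j<length [y, 1]. of_rat (c j) * [y, 1] ! j)"
    using rat_span_set_list[of "[y, 1]"] \<open>y \<noteq> 1\<close> by auto
  then obtain p q where pq: "y ^ 2 = of_rat p * y + of_rat q" by (auto simp: numeral_2_eq_2)
  obtain a b where quot: "quotient_of (p ^ 2 + 4 * q) = (a, b)" by fastforce
  note a = quotient_of_div[OF quot]
  have b: "b \<noteq> 0" using quotient_of_denom_pos[OF quot] by simp
  \<comment> \<open>Completing the square: \<open>2 * y - p\<close> has square
    \<open>p ^ 2 + 4 * q = a / b\<close>, and the factor \<open>b\<close> turns this into the
    integer \<open>a * b\<close>.\<close>
  define z where "z = of_int b * (2 * y - of_rat p)"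
  show thesis
  proof
    have "2 * y \<in> L" using subfield_add[OF L(1) y(1) y(1)] by (simp only: mult_2)
    from subfield_mult[OF L(1) subfield_of_int[OF L(1)] subfield_diff[OF L(1) this subfield_of_rat[OF L(1)]]]
    show "z \<in> L" unfolding z_def .
    have "z ^ 2 = of_int b ^ 2 * (4 * y ^ 2 - 4 * (of_rat p * y) + of_rat p ^ 2)"
      by (simp add: z_def power_mult_distrib power2_diff)
    also have "4 * y ^ 2 - 4 * (of_rat p * y) + of_rat p ^ 2 = of_rat (p ^ 2 + 4 * q)"
      unfolding pq distrib_left of_rat_add of_rat_mult of_rat_power by simp
    also have "of_int b ^ 2 * of_rat (p ^ 2 + 4 * q) = (of_int (a * b) :: 'a)"
      unfolding a using b by (simp add: of_rat_divide power2_eq_square)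
    finally show "z ^ 2 = of_int (a * b)" .
    show "z \<notin> \<rat>"
    proof
      assume "z \<in> \<rat>"
      then have "(z / of_int b + of_rat p) / 2 \<in> \<rat>" by simp
      then show False using y(2) b by (simp add: z_def)
    qed
  qed
qed

lemma quadratic_field_trace:
  assumes "quadratic_field L" and z: "z \<in> L" "z ^ 2 = of_int N" "z \<notin> \<rat>"
  shows "L = range (\<lambda>(r, s). of_rat r + of_rat s * z)"
    and "field_trace L (of_rat r + of_rat s * z) = 2 * r"
proof -
  have L: "is_subfield L" "ratvs.dim L = 2" using assms by (auto simp: number_field_deg_def)
  have sp1: "ratvs.span {1} = \<rat>" by (simp add: ratvs.span_singleton Rats_def)
  have "z \<noteq> 1" using z by auto
  have "ratvs.independent {z, 1}"
    using z by (intro ratvs.independent_insertI) (simp_all add: sp1 ratvs.independent_empty)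
  then have ind: "ratvs.independent (set [1, z])" by (simp add: insert_commute)
  have sp: "ratvs.span (set [1, z]) = L"
    using rat_span_eq_if_card_eq_dim[OF subfield_subspace[OF L(1)] ind] L z(1) \<open>z \<noteq> 1\<close> subfield_1[OF L(1)]
    by simp
  have d: "distinct [1, z]" using \<open>z \<noteq> 1\<close> by auto
  have e: "(\<Sum>j<length [1, z]. of_rat (c j) * [1, z] ! j) = of_rat (c 0) + of_rat (c 1) * z" for c
    by (simp add: numeral_2_eq_2)
  show "L = range (\<lambda>(r, s). of_rat r + of_rat s * z)"
  proof
    show "L \<subseteq> range (\<lambda>(r, s). of_rat r + of_rat s * z)"
      unfolding sp[symmetric] rat_span_set_list[OF d] e by auto
    show "range (\<lambda>(r, s). of_rat r + of_rat s * z) \<subseteq> L"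
      using z(1) by (auto intro!: subfield_add[OF L(1)] subfield_mult[OF L(1)] subfield_of_rat[OF L(1)])
  qed
  define A where "A i j = (if i = j then r else if i = 0 then s else s * of_int N)" for i j :: nat
  have "field_trace L (of_rat r + of_rat s * z) = (\<Sum>i<length [1, z]. A i i)"
  proof (rule field_trace_eq_matrix_trace[where A = A, OF L(1) d ind sp])
    show "of_rat r + of_rat s * z \<in> L"
      using z(1) by (auto intro!: subfield_add[OF L(1)] subfield_mult[OF L(1)] subfield_of_rat[OF L(1)])
    fix i assume "i < length [1, z]"
    then have "i = 0 \<or> i = 1" by auto
    then show "(of_rat r + of_rat s * z) * [1, z] ! i = (\<Sum>j<length [1, z]. of_rat (A i j) * [1, z] ! j)"
      unfolding e using z(2)
      by (auto simp: A_def of_rat_mult algebra_simps power2_eq_square)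
  qed
  then show "field_trace L (of_rat r + of_rat s * z) = 2 * r" by (simp add: A_def)
qed

theorem fundamental_discriminant_imp_minimal:
  assumes "fundamental_discriminant D" "D = g ^ 2 * E" "D \<noteq> 0" "[E = 0] (mod 4) \<or> [E = 1] (mod 4)"
  shows "g ^ 2 = 1"
proof -
  obtain L :: "complex set" where L: "quadratic_field L" "has_discriminant L D"
    using assms(1) unfolding fundamental_discriminant_def by blast
  have Ls: "is_subfield L" using L by (simp add: number_field_deg_def)
  obtain z and N :: int where z: "z \<in> L" "z ^ 2 = of_int N" "z \<notin> \<rat>"
    using quadratic_field_generator[OF L(1)] by blast
  note T = quadratic_field_trace[OF L(1) z]
  have O1: "1 \<in> ring_of_integers L"
    using subfield_1[OF Ls] int_imp_algebraic_int[of 1] by (simp add: ring_of_integers_def)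
  have Oz: "z \<in> ring_of_integers L"
    using z algebraic_int_if_quadratic[of z 0 N] by (simp add: ring_of_integers_def)
  have sp: "L \<subseteq> ratvs.span (ring_of_integers L)"
  proof
    fix x assume "x \<in> L"
    then obtain r s where "x = of_rat r * 1 + of_rat s * z" using T(1) by auto
    then show "x \<in> ratvs.span (ring_of_integers L)"
      using O1 Oz by (metis ratvs.span_add ratvs.span_scale ratvs.span_base)
  qed
  have gram: "\<exists>m::int. field_trace L 1 * field_trace L (x * x) - field_trace L x ^ 2 = of_int (m ^ 2 * D)"
    if "x \<in> ring_of_integers L" for x
    using gram_det_eq_square_mult_discriminant[OF L sp, of "[1, x]"] that O1
    by (simp add: det_2_mat power2_eq_square)
  have T1: "field_trace L 1 = 2" using T(2)[of 1 0] by simp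
  have Tz: "field_trace L z = 0" using T(2)[of 0 1] by simp
  have Tzz: "field_trace L (z * z) = 2 * of_int N"
    using T(2)[of "of_int N" 0] z(2) by (simp add: power2_eq_square)
  \<comment> \<open>The Gram determinant of \<open>1, z\<close> is \<open>4 * N\<close>; this ties
    the generator \<open>z\<close> to the discriminant \<open>D\<close>.\<close>
  obtain m :: int where "of_int (4 * N) = (of_int (m ^ 2 * D) :: rat)"
    using gram[OF Oz] by (auto simp: T1 Tz Tzz)
  then have m: "4 * N = m ^ 2 * D" by (simp only: of_int_eq_iff)
  have "N \<noteq> 0" using z by auto
  then have m0: "m \<noteq> 0" using m by auto
  have g0: "g \<noteq> 0" "E \<noteq> 0" using assms by auto
  \<comment> \<open>Chosen to be a square root of \<open>E\<close>: its square is
    \<open>4 * N / (g * m) ^ 2 = D / g ^ 2\<close>.\<close>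
  define w where "w = of_rat (2 / of_int (g * m)) * z"
  have "w ^ 2 = 4 * of_int N / (of_int g * of_int m) ^ 2"
    using z(2) by (simp add: w_def of_rat_divide of_rat_mult power_divide power_mult_distrib)
  also have "4 * of_int N = (of_int (m ^ 2 * D) :: complex)"
    using arg_cong[OF m, of "of_int :: int \<Rightarrow> complex"] by simp
  also have "\<dots> / (of_int g * of_int m) ^ 2 = of_int E"
    using m0 g0 by (simp add: assms(2) power_mult_distrib)
  finally have w: "w ^ 2 = of_int E" .
  define x where "x = (of_int E + w) / 2"
  have x: "x = of_rat (of_int E / 2) + of_rat (1 / of_int (g * m)) * z"
    by (simp add: x_def w_def of_rat_divide add_divide_distrib)
  have xL: "x \<in> L" unfolding x T(1) by (rule image_eqI[of _ _ "(of_int E / 2, 1 / of_int (g * m))"]) simp_all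
  have xx: "x * x = (of_int E ^ 2 + of_int E) / 4 + of_int E * w / 2"
    unfolding x_def using w by (simp add: power2_eq_square field_simps)
  then have xx': "x * x = of_rat ((of_int E ^ 2 + of_int E) / 4) + of_rat (of_int E / of_int (g * m)) * z"
    by (simp add: w_def of_rat_divide of_rat_add of_rat_power)
  have "4 dvd E ^ 2 - E"
  proof -
    have "4 dvd E \<or> 4 dvd E - 1" using assms(4) by (simp add: cong_iff_dvd_diff)
    moreover have "E ^ 2 - E = E * (E - 1)" by (simp add: power2_eq_square algebra_simps)
    ultimately show ?thesis by auto
  qed
  then obtain k where k: "E ^ 2 - E = 4 * k" by (rule dvdE)
  \<comment> \<open>The minimal equation of \<open>(E + w) / 2\<close>; its constant term
    \<open>(E ^ 2 - E) / 4\<close> is integral by the congruence on \<open>E\<close>.\<close>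
  have "x ^ 2 = of_int E * x + of_int (- k)"
  proof -
    have "4 * of_int k = (of_int E ^ 2 - of_int E :: complex)"
      using arg_cong[OF k, of "of_int :: int \<Rightarrow> complex"] by simp
    moreover have "4 * (x * x) = of_int E ^ 2 + of_int E + 2 * (of_int E * w)" by (simp add: xx)
    moreover have "4 * (of_int E * x) = 2 * (of_int E * of_int E) + 2 * (of_int E * w)"
    proof -
      have "4 * (of_int E * x) = 2 * (of_int E * (2 * x))" by simp
      also have "2 * x = of_int E + w" by (simp add: x_def)
      finally show ?thesis by (simp only: distrib_left)
    qed
    ultimately have "4 * x ^ 2 = 4 * (of_int E * x + of_int (- k))"
      unfolding power2_eq_square distrib_left of_int_minus by simp
    then show ?thesis by (simp only: mult_cancel_left) simp
  qed
  then have "x \<in> ring_of_integers L"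
    using xL algebraic_int_if_quadratic[of x E "- k"] by (simp only: ring_of_integers_def mem_Collect_eq)
  then obtain m' :: int where m': "2 * field_trace L (x * x) - field_trace L x ^ 2 = of_int (m' ^ 2 * D)"
    using gram[of x] unfolding T1 by blast
  have Tx: "field_trace L x = of_int E" unfolding x T(2) by simp
  have Txx: "field_trace L (x * x) = (of_int E ^ 2 + of_int E) / 2" unfolding xx' T(2) by simp
  \<comment> \<open>The Gram determinant of \<open>1, x\<close> is \<open>E\<close>. So
    \<open>D\<close> and \<open>E\<close> are square multiples of each other.\<close>
  have "of_int E = (of_int (m' ^ 2 * D) :: rat)" using m' unfolding Tx Txx by (simp add: field_simps)
  then have E: "E = m' ^ 2 * D" by (simp only: of_int_eq_iff)
  have "E * (m' ^ 2 * g ^ 2) = m' ^ 2 * (g ^ 2 * E)" by (simp only: mult_ac)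
  also have "\<dots> = E * 1" by (simp only: assms(2)[symmetric] E[symmetric] mult_1_right)
  finally have "m' ^ 2 * g ^ 2 = 1" using g0 by (metis mult_cancel_left)
  then show "g ^ 2 = 1" by (metis pos_zmult_eq_1_iff zero_less_power2 g0(1) mult.commute)
qed

section \<open>Primitivity of forms of discriminant \<open>-3 * D\<close>\<close>

lemma square_mod_4_int:
  fixes n :: int
  shows "n ^ 2 mod 4 = (if even n then 0 else 1)"
proof (cases "even n")
  case True
  then obtain k where "n = 2 * k" by (rule evenE)
  then show ?thesis by (simp add: power2_eq_square)
next
  case False
  then obtain k where "n = 2 * k + 1" by (rule oddE)
  then have e: "n ^ 2 = 1 + 4 * (k ^ 2 + k)" by (simp add: power2_eq_square algebra_simps)
  have "(1 + 4 * m) mod 4 = 1" for m :: int by presburger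
  from this[of "k ^ 2 + k"] show ?thesis using False by (simp only: e if_False)
qed

text \<open>The square of the content \<open>g\<close> divides \<open>-3 * D\<close>. As 3 does not
  divide \<open>g\<close>, the factor 3 can be removed from the cofactor, and \<open>g ^ 2\<close>
  splits off \<open>D\<close> with a quotient that is again 0 or 1 modulo 4.\<close>

lemma quad_primitive_if_fundamental:
  assumes "fundamental_discriminant D" "\<not> 3 dvd D" "quad_disc f = - 3 * D"
  shows "quad_primitive f"
proof -
  obtain A B C where f: "f = (A, B, C)" by (metis prod_cases3)
  define g where "g = gcd A (gcd B C)"
  obtain A' B' C' where g: "A = g * A'" "B = g * B'" "C = g * C'"
  proof -
    have "g dvd A" "g dvd B" "g dvd C"
      unfolding g_def by (rule gcd_dvd1 dvd_trans[OF gcd_dvd2 gcd_dvd1] dvd_trans[OF gcd_dvd2 gcd_dvd2])+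
    then show thesis using that by (metis dvdE)
  qed
  define E' where "E' = B' ^ 2 - 4 * A' * C'"
  have e: "g ^ 2 * E' = - 3 * D"
    using assms(3) by (simp add: f g E'_def power2_eq_square algebra_simps)
  have "\<not> 3 dvd g"
  proof
    assume "3 dvd g"
    then obtain k where "g = 3 * k" by (rule dvdE)
    then have "3 * (3 * k ^ 2 * E') = 3 * (- D)" using e by (simp add: power2_eq_square algebra_simps)
    then have "- D = 3 * (k ^ 2 * E')" by linarith
    then show False using assms(2) by (metis dvd_minus_iff dvd_triv_left)
  qed
  moreover have p3: "prime (3::int)" by simp
  moreover have "3 dvd g ^ 2 * E'" unfolding e by simp
  ultimately have "3 dvd E'"
    using prime_dvd_multD[OF p3] prime_dvd_power[OF p3] by blast
  then obtain F where F: "E' = 3 * F" by (rule dvdE)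
  then have D: "D = g ^ 2 * (- F)" using e by (simp add: algebra_simps)
  have "D \<noteq> 0" using assms(2) by auto
  have "[- F = 0] (mod 4) \<or> [- F = 1] (mod 4)"
  proof -
    have "B' ^ 2 mod 4 = 0 \<or> B' ^ 2 mod 4 = 1" by (simp add: square_mod_4_int)
    \<comment> \<open>Since \<open>E' = 3 * F\<close>, one has \<open>- F = E' - 4 * F\<close>, so
      \<open>- F\<close> and the discriminant \<open>E'\<close> agree modulo 4.\<close>
    moreover have "- F = B' ^ 2 - 4 * (A' * C' + F)" using F E'_def by (simp add: algebra_simps)
    moreover have "(t - 4 * n) mod 4 = t mod 4" for t n :: int by presburger
    ultimately have "(- F) mod 4 = 0 \<or> (- F) mod 4 = 1" by metis
    then show ?thesis by (simp add: cong_def)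
  qed
  then have "g ^ 2 = 1" using fundamental_discriminant_imp_minimal[OF assms(1) D \<open>D \<noteq> 0\<close>] by blast
  moreover have "g \<ge> 0" by (simp add: g_def)
  ultimately have "g = 1" by (simp add: power2_eq_1_iff)
  then show ?thesis by (simp add: f g_def)
qed

section \<open>Delone-Faddeev bases\<close>

text \<open>Coefficients are attached to list positions instead of elements. A repeated entry would
  give a relation with coefficients 1 and -1, so independence by position already contains
  distinctness.\<close>

lemma int_basis_iff_unique_coeffs:
  "int_basis ws M \<longleftrightarrow>
     (\<forall>c. (\<Sum>j<length ws. of_int (c j) * ws ! j) = 0 \<longrightarrow> (\<forall>j<length ws. c j = 0)) \<and>
     M = range (\<lambda>c. \<Sum>j<length ws. of_int (c j) * ws ! j)"
  (is "_ \<longleftrightarrow> ?I \<and> ?S")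
proof (cases "distinct ws")
  case True
  have bij: "bij_betw ((!) ws) {..<length ws} (set ws)"
    using True by (simp add: bij_betw_nth)
  have e: "(\<Sum>v\<in>set ws. f v) = (\<Sum>j<length ws. f (ws ! j))" for f :: "'a \<Rightarrow> 'a"
    using sum.reindex_bij_betw[OF bij, of f] by simp
  have "intmod.independent (set ws) \<longleftrightarrow> ?I"
  proof
    assume I: ?I
    show "intmod.independent (set ws)"
    proof
      assume "intmod.dependent (set ws)"
      then obtain u v where "v \<in> set ws" "u v \<noteq> 0" "(\<Sum>v\<in>set ws. of_int (u v) * v) = 0"
        unfolding intmod.dependent_finite[OF finite_set] by blast
      then show False using I[rule_format, of "\<lambda>j. u (ws ! j)"] by (auto simp: e in_set_conv_nth)
    qed
  next
    assume ind: "intmod.independent (set ws)"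
    show ?I
    proof (intro allI impI)
      fix c j assume s: "(\<Sum>j<length ws. of_int (c j) * ws ! j) = 0" and j: "j < length ws"
      define h where "h v = c (the_inv_into {..<length ws} ((!) ws) v)" for v
      have h: "h (ws ! j) = c j" if "j < length ws" for j
        using bij that by (simp add: h_def bij_betw_def the_inv_into_f_f)
      have "(\<Sum>v\<in>set ws. of_int (h v) * v) = 0" using s by (simp add: e h)
      then have "h (ws ! j) = 0"
        using intmod.independentD[OF ind finite_set subset_refl] j by auto
      then show "c j = 0" using h j by simp
    qed
  qed
  then show ?thesis using True int_span_set_list[OF True] by (auto simp: int_basis_def)
next
  case False
  then obtain i k where ik: "i < length ws" "k < length ws" "i \<noteq> k" "ws ! i = ws ! k"
    by (auto simp: distinct_conv_nth)
  define c :: "nat \<Rightarrow> int" where "c j = (if j = i then 1 else 0) - (if j = k then 1 else 0)" for j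
  have "(\<Sum>j<length ws. of_int (c j) * ws ! j)
    = (\<Sum>j<length ws. (if j = i then ws ! j else 0) - (if j = k then ws ! j else 0))"
    by (intro sum.cong) (auto simp: c_def)
  also have "\<dots> = 0" using ik by (simp add: sum_subtractf)
  finally have "\<not> ?I" using ik by (auto simp: c_def intro!: exI[of _ c] exI[of _ i])
  then show ?thesis using False by (auto simp: int_basis_def)
qed

lemma int_basis_2_iff:
  "int_basis [x, y] M \<longleftrightarrow>
     (\<forall>k l. of_int k * x + of_int l * y = 0 \<longrightarrow> k = 0 \<and> l = 0) \<and>
     M = {of_int k * x + of_int l * y | k l. True}" (is "_ \<longleftrightarrow> ?I \<and> ?S")
proof -
  let ?c = "\<lambda>k l j. if j = 0 then k else l :: int"
  have e: "(\<Sum>j<length [x, y]. of_int (c j) * [x, y] ! j) = of_int (c 0) * x + of_int (c 1) * y"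
    for c :: "nat \<Rightarrow> int" by (simp add: numeral_2_eq_2)
  have l: "(\<forall>j<length [x, y]. c j = 0) \<longleftrightarrow> c 0 = 0 \<and> c 1 = 0" for c :: "nat \<Rightarrow> int"
    by (auto simp: less_Suc_eq numeral_2_eq_2)
  have "(\<forall>c :: nat \<Rightarrow> int. of_int (c 0) * x + of_int (c 1) * y = 0 \<longrightarrow> c 0 = 0 \<and> c 1 = 0) \<longleftrightarrow> ?I"
  proof (intro iffI allI impI)
    fix k l
    assume "\<forall>c :: nat \<Rightarrow> int. of_int (c 0) * x + of_int (c 1) * y = 0 \<longrightarrow> c 0 = 0 \<and> c 1 = 0"
      "of_int k * x + of_int l * y = 0"
    then show "k = 0 \<and> l = 0" by (auto dest!: spec[of _ "?c k l"])
  qed blast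
  moreover have "range (\<lambda>c :: nat \<Rightarrow> int. of_int (c 0) * x + of_int (c 1) * y)
    = {of_int k * x + of_int l * y | k l. True}"
  proof (intro equalityI subsetI)
    fix w assume "w \<in> {of_int k * x + of_int l * y | k l. True}"
    then obtain k l where "w = of_int k * x + of_int l * y" by blast
    then show "w \<in> range (\<lambda>c :: nat \<Rightarrow> int. of_int (c 0) * x + of_int (c 1) * y)"
      by (intro image_eqI[of _ _ "?c k l"]) simp_all
  qed auto
  ultimately show ?thesis unfolding int_basis_iff_unique_coeffs e l by simp
qed

lemma int_basis_3_iff:
  "int_basis [x, y, z] M \<longleftrightarrow>
     (\<forall>k l m. of_int k * x + of_int l * y + of_int m * z = 0 \<longrightarrow> k = 0 \<and> l = 0 \<and> m = 0) \<and>
     M = {of_int k * x + of_int l * y + of_int m * z | k l m. True}" (is "_ \<longleftrightarrow> ?I \<and> ?S")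
proof -
  let ?c = "\<lambda>k l m j. if j = 0 then k else if j = 1 then l else m :: int"
  have e: "(\<Sum>j<length [x, y, z]. of_int (c j) * [x, y, z] ! j)
    = of_int (c 0) * x + of_int (c 1) * y + of_int (c 2) * z"
    for c :: "nat \<Rightarrow> int" by (simp add: numeral_3_eq_3 numeral_2_eq_2)
  have l: "(\<forall>j<length [x, y, z]. c j = 0) \<longleftrightarrow> c 0 = 0 \<and> c 1 = 0 \<and> c 2 = 0" for c :: "nat \<Rightarrow> int"
    by (auto simp: less_Suc_eq numeral_3_eq_3 numeral_2_eq_2)
  have "(\<forall>c :: nat \<Rightarrow> int. of_int (c 0) * x + of_int (c 1) * y + of_int (c 2) * z = 0
      \<longrightarrow> c 0 = 0 \<and> c 1 = 0 \<and> c 2 = 0) \<longleftrightarrow> ?I"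
  proof (intro iffI allI impI)
    fix k l m
    assume "\<forall>c :: nat \<Rightarrow> int. of_int (c 0) * x + of_int (c 1) * y + of_int (c 2) * z = 0
      \<longrightarrow> c 0 = 0 \<and> c 1 = 0 \<and> c 2 = 0" "of_int k * x + of_int l * y + of_int m * z = 0"
    then show "k = 0 \<and> l = 0 \<and> m = 0" by (auto dest!: spec[of _ "?c k l m"])
  qed blast
  moreover have "range (\<lambda>c :: nat \<Rightarrow> int. of_int (c 0) * x + of_int (c 1) * y + of_int (c 2) * z)
    = {of_int k * x + of_int l * y + of_int m * z | k l m. True}"
  proof (intro equalityI subsetI)
    fix w assume "w \<in> {of_int k * x + of_int l * y + of_int m * z | k l m. True}"
    then obtain k l m where "w = of_int k * x + of_int l * y + of_int m * z" by blast
    then show "w \<in> range (\<lambda>c :: nat \<Rightarrow> int. of_int (c 0) * x + of_int (c 1) * y + of_int (c 2) * z)"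
      by (intro image_eqI[of _ _ "?c k l m"]) simp_all
  qed auto
  ultimately show ?thesis unfolding int_basis_iff_unique_coeffs e l by simp
qed

section \<open>Change of variables in binary cubic forms\<close>

lemma cubic_subst_coeffs:
  assumes e: "\<And>x y :: int. cubic_eval (a, b, c, d) x y
    = cubic_eval (a0, b0, c0, d0) (p * x + q * y) (r * x + s * y)"
  shows "a = a0 * p ^ 3 + b0 * p ^ 2 * r + c0 * p * r ^ 2 + d0 * r ^ 3"
    and "b = 3 * a0 * p ^ 2 * q + b0 * (p ^ 2 * s + 2 * p * q * r) + c0 * (q * r ^ 2 + 2 * p * r * s)
      + 3 * d0 * r ^ 2 * s"
    and "c = 3 * a0 * p * q ^ 2 + b0 * (q ^ 2 * r + 2 * p * q * s) + c0 * (p * s ^ 2 + 2 * q * r * s)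
      + 3 * d0 * r * s ^ 2"
    and "d = a0 * q ^ 3 + b0 * q ^ 2 * s + c0 * q * s ^ 2 + d0 * s ^ 3"
proof -
  show a: "a = a0 * p ^ 3 + b0 * p ^ 2 * r + c0 * p * r ^ 2 + d0 * r ^ 3"
    using e[of 1 0] by simp
  show d: "d = a0 * q ^ 3 + b0 * q ^ 2 * s + c0 * q * s ^ 2 + d0 * s ^ 3"
    using e[of 0 1] by simp
  \<comment> \<open>With the outer coefficients known, the sum and the difference of these two
    values isolate \<open>b\<close> and \<open>c\<close>.\<close>
  note s = e[of 1 1] e[of 1 "-1"]
  show "b = 3 * a0 * p ^ 2 * q + b0 * (p ^ 2 * s + 2 * p * q * r) + c0 * (q * r ^ 2 + 2 * p * r * s)
      + 3 * d0 * r ^ 2 * s"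
    "c = 3 * a0 * p * q ^ 2 + b0 * (q ^ 2 * r + 2 * p * q * s) + c0 * (p * s ^ 2 + 2 * q * r * s)
      + 3 * d0 * r * s ^ 2"
    using s unfolding a d by (simp_all add: power2_eq_square power3_eq_cube algebra_simps)
qed

text \<open>\<open>gl2_equiv\<close> speaks of integer arguments; as an identity of coefficients it
  holds in every commutative ring, in particular at a root in the field.\<close>

lemma cubic_eval_subst:
  fixes x y :: "'a::comm_ring_1"
  assumes "\<And>x y :: int. cubic_eval (a, b, c, d) x y
    = cubic_eval (a0, b0, c0, d0) (p * x + q * y) (r * x + s * y)"
  shows "cubic_eval (a, b, c, d) x y = cubic_eval (a0, b0, c0, d0)
    (of_int p * x + of_int q * y) (of_int r * x + of_int s * y)"
  unfolding cubic_subst_coeffs[OF assms]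
  by (simp add: power2_eq_square power3_eq_cube algebra_simps)

text \<open>The basis element 1 absorbs the shifts \<open>k\<close> and \<open>k'\<close>, and the
  remaining change is by an integral matrix of determinant \<open>\<delta>\<close>. Recording the
  sign through \<open>\<delta> * \<delta> = 1\<close> lets \<open>\<delta>\<close> act as its own
  inverse, without a case distinction.\<close>

lemma int_basis_unimodular:
  fixes \<alpha> \<beta> :: "'a::field_char_0"
  assumes b: "int_basis [1, \<alpha>', \<beta>'] M"
    and det: "p * s - q * r = \<delta>" "\<delta> * \<delta> = 1"
    and \<alpha>': "\<alpha>' = of_int s * \<alpha> - of_int r * \<beta> + of_int k"
    and \<beta>': "\<beta>' = of_int p * \<beta> - of_int q * \<alpha> + of_int k'"
  shows "int_basis [1, \<alpha>, \<beta>] M"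
proof -
  have ind: "n0 = 0 \<and> n1 = 0 \<and> n2 = 0" if "of_int n0 * 1 + of_int n1 * \<alpha>' + of_int n2 * \<beta>' = 0" for n0 n1 n2
    using b that unfolding int_basis_3_iff by blast
  have M: "M = {of_int n0 * 1 + of_int n1 * \<alpha>' + of_int n2 * \<beta>' | n0 n1 n2. True}"
    using b unfolding int_basis_3_iff by blast
  have inv: "\<alpha> = of_int \<delta> * (of_int p * (\<alpha>' - of_int k) + of_int r * (\<beta>' - of_int k'))"
    "\<beta> = of_int \<delta> * (of_int q * (\<alpha>' - of_int k) + of_int s * (\<beta>' - of_int k'))"
  proof -
    have d: "of_int \<delta> * (of_int p * of_int s - of_int q * of_int r) = (1 :: 'a)"
      using det by (metis of_int_1 of_int_diff of_int_mult)
    have "of_int \<delta> * (of_int p * (\<alpha>' - of_int k) + of_int r * (\<beta>' - of_int k'))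
      = of_int \<delta> * (of_int p * of_int s - of_int q * of_int r) * \<alpha>"
      "of_int \<delta> * (of_int q * (\<alpha>' - of_int k) + of_int s * (\<beta>' - of_int k'))
      = of_int \<delta> * (of_int p * of_int s - of_int q * of_int r) * \<beta>"
      unfolding \<alpha>' \<beta>' add_diff_cancel_right' by (simp_all only: ring_distribs mult_ac) simp_all
    then show "\<alpha> = of_int \<delta> * (of_int p * (\<alpha>' - of_int k) + of_int r * (\<beta>' - of_int k'))"
      "\<beta> = of_int \<delta> * (of_int q * (\<alpha>' - of_int k) + of_int s * (\<beta>' - of_int k'))"
      unfolding d by simp_all
  qed
  have conv: "of_int n0 * 1 + of_int n1 * \<alpha> + of_int n2 * \<beta>
    = of_int (n0 - \<delta> * (n1 * (p * k + r * k') + n2 * (q * k + s * k'))) * 1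
      + of_int (\<delta> * (n1 * p + n2 * q)) * \<alpha>' + of_int (\<delta> * (n1 * r + n2 * s)) * \<beta>'" for n0 n1 n2
    by (subst inv(1), subst inv(2))
       (simp only: of_int_add of_int_diff of_int_mult ring_distribs mult_ac mult_1_right, simp)
  have conv': "of_int n0 * 1 + of_int n1 * \<alpha>' + of_int n2 * \<beta>'
    = of_int (n0 + n1 * k + n2 * k') * 1 + of_int (n1 * s - n2 * q) * \<alpha> + of_int (n2 * p - n1 * r) * \<beta>"
    for n0 n1 n2
    unfolding \<alpha>' \<beta>'
    by (simp only: of_int_add of_int_diff of_int_mult ring_distribs mult_ac mult_1_right, simp)
  show ?thesis
    unfolding int_basis_3_iff
  proof (intro conjI allI impI)
    fix n0 n1 n2 assume "of_int n0 * 1 + of_int n1 * \<alpha> + of_int n2 * \<beta> = 0"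
    from ind[OF this[unfolded conv]]
    have z: "n1 * p + n2 * q = 0" "n1 * r + n2 * s = 0"
      "n0 = \<delta> * (n1 * (p * k + r * k') + n2 * (q * k + s * k'))"
      using det(2) by auto
    have "n1 * \<delta> = s * (n1 * p + n2 * q) - q * (n1 * r + n2 * s)"
      "n2 * \<delta> = p * (n1 * r + n2 * s) - r * (n1 * p + n2 * q)"
      by (simp_all add: det(1)[symmetric] algebra_simps)
    then show "n1 = 0" "n2 = 0" using z det(2) by auto
    then show "n0 = 0" using z(3) by simp
  next
    show "M = {of_int n0 * 1 + of_int n1 * \<alpha> + of_int n2 * \<beta> | n0 n1 n2. True}"
    proof (intro equalityI subsetI)
      fix x assume "x \<in> M"
      then show "x \<in> {of_int n0 * 1 + of_int n1 * \<alpha> + of_int n2 * \<beta> | n0 n1 n2. True}"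
        unfolding M using conv' by blast
    next
      fix x assume "x \<in> {of_int n0 * 1 + of_int n1 * \<alpha> + of_int n2 * \<beta> | n0 n1 n2. True}"
      then show "x \<in> M" unfolding M using conv by blast
    qed
  qed
qed

section \<open>Composition with \<open>C\<close>\<close>

lemma quad_pos_def_iff_first_coeff:
  assumes "quad_disc (A, B, C) < 0"
  shows "quad_pos_def (A, B, C) \<longleftrightarrow> A > 0"
proof
  assume "quad_pos_def (A, B, C)"
  from this[unfolded quad_pos_def_def, rule_format, of 1 0] show "A > 0" by simp
next
  assume A: "A > 0"
  show "quad_pos_def (A, B, C)" unfolding quad_pos_def_def
  proof (intro allI impI)
    fix x y :: int assume xy: "(x, y) \<noteq> (0, 0)"
    have e: "4 * A * quad_eval (A, B, C) x y = (2 * A * x + B * y) ^ 2 + (4 * A * C - B ^ 2) * y ^ 2"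
      by (simp add: power2_eq_square algebra_simps)
    have p: "4 * A * C - B ^ 2 > 0" using assms by simp
    have "4 * A * quad_eval (A, B, C) x y > 0"
    proof (cases "y = 0")
      case True
      then show ?thesis using xy A unfolding e by simp
    next
      case False
      then have "(4 * A * C - B ^ 2) * y ^ 2 > 0" using p by simp
      then show ?thesis unfolding e by (simp add: add_nonneg_pos)
    qed
    then show "quad_eval (A, B, C) x y > 0" using A by (simp add: zero_less_mult_iff)
  qed
qed

text \<open>The prime 3 divides \<open>-3 * D\<close> exactly once.\<close>

lemma neg_three_mult_not_square:
  fixes D n :: int
  assumes "\<not> 3 dvd D"
  shows "n ^ 2 \<noteq> - 3 * D"
proof
  assume n: "n ^ 2 = - 3 * D"
  have "prime (3::int)" by simp
  moreover have "3 dvd n ^ 2" unfolding n by simp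
  ultimately have "3 dvd n" using prime_dvd_power by blast
  then obtain k where "n = 3 * k" by (rule dvdE)
  then have "D = 3 * (- (k ^ 2))" using n by (simp add: power2_eq_square)
  then show False using assms by (metis dvd_triv_left)
qed

lemma fundamental_forms_of_disc:
  assumes "fundamental_discriminant D" "\<not> 3 dvd D" "quad_disc (A, B, C) = - 3 * D" "D > 0 \<longrightarrow> A > 0"
  shows "(A, B, C) \<in> forms_of_disc (- 3 * D)"
  using quad_primitive_if_fundamental[OF assms(1-3)] quad_pos_def_iff_first_coeff[of A B C] assms(3,4)
  unfolding forms_of_disc_def by auto

lemma sl2_relI:
  assumes "f \<in> forms_of_disc \<Delta>" "g \<in> forms_of_disc \<Delta>" "p * s - q * r = 1" "g = quad_subst f p q r s"
  shows "(f, g) \<in> sl2_rel \<Delta>"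
  using assms quad_eval_subst unfolding sl2_rel_def by blast

lemma hessian_class_product:
  assumes fund: "fundamental_discriminant D" and D3: "\<not> 3 dvd D"
    and disc: "quad_disc (A * 3, B, C) = - 3 * D" and pos: "D > 0 \<longrightarrow> A > 0"
    and C\<^sub>D: "([D = 0] (mod 4) \<and> C\<^sub>D = (3, 0, D div 4)) \<or> ([D = 1] (mod 4) \<and> C\<^sub>D = (3, 3, (D + 3) div 4))"
  shows "(A, B, 3 * C) \<in> forms_of_disc (- 3 * D)" "C\<^sub>D \<in> forms_of_disc (- 3 * D)"
    "(A * 3, B, C) \<in> forms_of_disc (- 3 * D)"
    "form_class (- 3 * D) (A, B, 3 * C) \<otimes>\<^bsub>narrow_class_group (- 3 * D)\<^esub> form_class (- 3 * D) C\<^sub>D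
      = form_class (- 3 * D) (A * 3, B, C)"
proof -
  have e: "B ^ 2 = 12 * (A * C) - 3 * D" using disc by (simp add: algebra_simps)
  have "prime (3::int)" by simp
  moreover have "3 dvd B ^ 2" unfolding e by simp
  ultimately have "3 dvd B" using prime_dvd_power by blast
  then obtain n where n: "B = 3 * n" by (rule dvdE)
  have e': "3 * n ^ 2 = 4 * (A * C) - D" using e by (simp add: n power2_eq_square)
  have par: "D mod 4 = (if even n then 0 else 1)"
    using square_mod_4_int[of n] e' by (cases "even n") (simp_all, presburger+)
  \<comment> \<open>The representative of the class of \<open>C\<^sub>D\<close> that shares the
    middle coefficient \<open>B\<close> with the other factor, as Dirichlet's composition
    requires.\<close>
  define G :: quad_form where "G = (3, B, A * C)"
  have G: "G \<in> forms_of_disc (- 3 * D)"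
    unfolding G_def by (rule fundamental_forms_of_disc[OF fund D3]) (use disc in simp_all)
  show F: "(A, B, 3 * C) \<in> forms_of_disc (- 3 * D)" "(A * 3, B, C) \<in> forms_of_disc (- 3 * D)"
    by (rule fundamental_forms_of_disc[OF fund D3]; use disc pos in simp)+
  \<comment> \<open>The shift by \<open>m\<close> changes the middle coefficient
    \<open>B = 3 * n\<close> by \<open>6 * m\<close>, so it can be brought to 0 or 3 according to
    the parity of \<open>n\<close>; that parity is the one prescribed by \<open>D\<close> modulo 4.
    The last coefficient is then forced by the discriminant.\<close>
  have "\<exists>m. C\<^sub>D = quad_subst G 1 m 0 1"
  proof (cases "even n")
    case True
    then obtain k where k: "n = 2 * k" by (rule evenE)
    have D4: "D = 4 * (A * C - 3 * k ^ 2)" using e' by (simp add: k power2_eq_square)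
    then have "C\<^sub>D = (3, 0, A * C - 3 * k ^ 2)" using C\<^sub>D by (auto simp: cong_def)
    then have "C\<^sub>D = quad_subst G 1 (- k) 0 1"
      by (simp add: G_def n k power2_eq_square algebra_simps)
    then show ?thesis by blast
  next
    case False
    then obtain k where k: "n = 2 * k + 1" by (rule oddE)
    have D4: "D + 3 = 4 * (A * C - 3 * k ^ 2 - 3 * k)"
      using e' by (simp add: k power2_eq_square algebra_simps)
    have "D mod 4 = 1" using par False by simp
    then have "C\<^sub>D = (3, 3, (D + 3) div 4)" using C\<^sub>D by (auto simp: cong_def)
    then have "C\<^sub>D = (3, 3, A * C - 3 * k ^ 2 - 3 * k)" unfolding D4 by simp
    then have "C\<^sub>D = quad_subst G 1 (- k) 0 1"
      by (simp add: G_def n k power2_eq_square algebra_simps)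
    then show ?thesis by blast
  qed
  then obtain m where m: "C\<^sub>D = quad_subst G 1 m 0 1" by blast
  have "C\<^sub>D = (fst C\<^sub>D, fst (snd C\<^sub>D), snd (snd C\<^sub>D))" by simp
  moreover have "quad_disc C\<^sub>D = - 3 * D"
    using G unfolding m quad_disc_subst by (simp add: forms_of_disc_def)
  moreover have "fst C\<^sub>D = 3" by (simp add: m G_def)
  ultimately show C': "C\<^sub>D \<in> forms_of_disc (- 3 * D)"
    using fundamental_forms_of_disc[OF fund D3, of 3 "fst (snd C\<^sub>D)" "snd (snd C\<^sub>D)"] by simp
  have "form_class (- 3 * D) C\<^sub>D = form_class (- 3 * D) G"
    by (rule sym, rule form_class_eq, rule sl2_relI[OF G C' _ m]) simp
  moreover have "direct_composition (A, B, 3 * C) G (A * 3, B, C)"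
    unfolding G_def by (rule dirichlet_composition)
  ultimately show "form_class (- 3 * D) (A, B, 3 * C) \<otimes>\<^bsub>narrow_class_group (- 3 * D)\<^esub> form_class (- 3 * D) C\<^sub>D
      = form_class (- 3 * D) (A * 3, B, C)"
    using form_class_mult[OF F(1) G F(2)] neg_three_mult_not_square[OF D3] by simp
qed

section \<open>The Hessian as an element of the class group\<close>

lemma quad_disc_hessian: "quad_disc (hessian F) = - 3 * cubic_disc F"
  by (cases F) (simp add: power2_eq_square power3_eq_cube algebra_simps)

text \<open>The covariant syzygy \<open>4 H\<^sup>3 = G\<^sup>2 + 27 D F\<^sup>2\<close>, evaluated at \<open>(1, 0)\<close>.\<close>

lemma hessian_syzygy:
  fixes a b c d :: int
  shows "4 * (b ^ 2 - 3 * a * c) ^ 3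
    = (2 * b ^ 3 - 9 * a * b * c + 27 * a ^ 2 * d) ^ 2 + 27 * a ^ 2 * cubic_disc (a, b, c, d)"
  by (simp add: power2_eq_square power3_eq_cube algebra_simps)

text \<open>For positive \<open>D\<close> the syzygy writes \<open>4 * P ^ 3\<close>, with
  \<open>P\<close> the leading coefficient of the Hessian, as a sum of nonnegative terms; and
  \<open>P = 0\<close> would make \<open>-3 * D\<close> the square of the middle
  coefficient.\<close>

lemma hessian_pos:
  assumes D: "\<not> 3 dvd D" "D = cubic_disc (a, b, c, d)" "D > 0"
  shows "b ^ 2 - 3 * a * c > 0"
proof -
  let ?P = "b ^ 2 - 3 * a * c"
  have "4 * ?P ^ 3 \<ge> 0" unfolding hessian_syzygy[of b a c d] using D by simp
  then have "?P \<ge> 0" by (simp add: zero_le_power_eq)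
  moreover have "?P \<noteq> 0"
  proof
    assume "?P = 0"
    then have "(b * c - 9 * a * d) ^ 2 = - 3 * D"
      using quad_disc_hessian[of "(a, b, c, d)"] D(2) by simp
    then show False using neg_three_mult_not_square[OF D(1)] by blast
  qed
  ultimately show ?thesis by simp
qed

lemma hessian_in_forms_of_disc:
  assumes "fundamental_discriminant D" "\<not> 3 dvd D" "D = cubic_disc (a, b, c, d)"
  shows "hessian (a, b, c, d) \<in> forms_of_disc (- 3 * D)"
  using fundamental_forms_of_disc[OF assms(1,2), of "b ^ 2 - 3 * a * c" "b * c - 9 * a * d" "c ^ 2 - 3 * b * d"]
    quad_disc_hessian[of "(a, b, c, d)"] hessian_pos[OF assms(2,3)] assms(3) by simp

text \<open>Primitivity is read off from the discriminant, so only definiteness has to be followed: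
  the new leading coefficient is the value of \<open>f\<close> at the nonzero vector
  \<open>(p, r)\<close>.\<close>

lemma quad_subst_in_forms_of_disc:
  assumes "fundamental_discriminant D" "\<not> 3 dvd D" "f \<in> forms_of_disc (- 3 * D)" "p * s - q * r = 1"
  shows "quad_subst f p q r s \<in> forms_of_disc (- 3 * D)"
proof -
  obtain A B C where g: "quad_subst f p q r s = (A, B, C)" by (metis prod_cases3)
  have "A > 0" if "D > 0"
  proof -
    have "quad_pos_def f" using assms(3) that by (simp add: forms_of_disc_def)
    moreover have "(p, r) \<noteq> (0, 0)" using assms(4) by auto
    ultimately have "quad_eval f p r > 0" unfolding quad_pos_def_def by blast
    then show "A > 0" using quad_eval_subst[of f p q r s 1 0] by (simp add: g)
  qed
  moreover have "quad_disc (A, B, C) = - 3 * D"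
    unfolding g[symmetric] quad_disc_subst using assms(3,4) by (simp add: forms_of_disc_def)
  ultimately show ?thesis unfolding g using fundamental_forms_of_disc[OF assms(1,2)] by blast
qed

text \<open>The shear by \<open>t\<close> moves the vector \<open>(1, t)\<close> to the front, where
  \<open>H\<close> takes a value congruent to \<open>(b - c t)^2\<close> modulo 3, hence divisible
  by 3. Tripling the second variable and dividing by 3 turns \<open>(3 A, Q, R)\<close> into
  \<open>(A, Q, 3 R)\<close>.\<close>

lemma half_trace_hessian_product_shear:
  assumes fund: "fundamental_discriminant D" and D3: "\<not> 3 dvd D" and D: "D = cubic_disc (a, b, c, d)"
    and H: "H = hessian (a, b, c, d)" and t: "[b = t * c] (mod 3)"
    and C\<^sub>D: "([D = 0] (mod 4) \<and> C\<^sub>D = (3, 0, D div 4)) \<or> ([D = 1] (mod 4) \<and> C\<^sub>D = (3, 3, (D + 3) div 4))"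
  shows "\<exists>q. (\<forall>x y. 3 * quad_eval q x y = quad_eval H x (t * x + 3 * y)) \<and>
    q \<in> forms_of_disc (- 3 * D) \<and> C\<^sub>D \<in> forms_of_disc (- 3 * D) \<and> H \<in> forms_of_disc (- 3 * D) \<and>
    form_class (- 3 * D) q \<otimes>\<^bsub>narrow_class_group (- 3 * D)\<^esub> form_class (- 3 * D) C\<^sub>D = form_class (- 3 * D) H"
proof -
  have HF: "H \<in> forms_of_disc (- 3 * D)" unfolding H by (rule hessian_in_forms_of_disc[OF fund D3 D])
  obtain P Q R where H': "quad_subst H 1 0 t 1 = (P, Q, R)" by (metis prod_cases3)
  have HF': "(P, Q, R) \<in> forms_of_disc (- 3 * D)"
    unfolding H'[symmetric] by (rule quad_subst_in_forms_of_disc[OF fund D3 HF]) simp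
  have "(H, (P, Q, R)) \<in> sl2_rel (- 3 * D)"
    by (rule sl2_relI[OF HF HF' _ H'[symmetric]]) simp
  then have cl: "form_class (- 3 * D) H = form_class (- 3 * D) (P, Q, R)" by (rule form_class_eq)
  have "3 dvd b - t * c" using t by (simp add: cong_iff_dvd_diff)
  then obtain k where k: "b = t * c + 3 * k" by (metis dvdE add_diff_cancel_left' add.commute diff_add_cancel)
  have "P = fst (quad_subst H 1 0 t 1)" by (simp only: H' fst_conv)
  also have "\<dots> = (b ^ 2 - 3 * a * c) + (b * c - 9 * a * d) * t + (c ^ 2 - 3 * b * d) * t ^ 2"
    by (simp add: H)
  also have "\<dots> = 3 * (t ^ 2 * c ^ 2 + 3 * k * t * c + 3 * k ^ 2 - a * c - 3 * a * d * t - b * d * t ^ 2)"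
    by (simp add: k power2_eq_square algebra_simps)
  finally obtain A where A: "P = A * 3" by (metis mult.commute)
  have pos: "A > 0" if "D > 0"
    using HF' that quad_pos_def_iff_first_coeff[of P Q R] by (simp add: forms_of_disc_def A)
  have "quad_disc (A * 3, Q, R) = - 3 * D" using HF' by (simp add: forms_of_disc_def A)
  note prod = hessian_class_product[OF fund D3 this _ C\<^sub>D]
  have "3 * quad_eval (A, Q, 3 * R) x y = quad_eval H x (t * x + 3 * y)" for x y
  proof -
    have "quad_eval H x (t * x + 3 * y) = quad_eval (P, Q, R) x (3 * y)"
      unfolding H'[symmetric] quad_eval_subst by simp
    then show ?thesis by (simp add: A power2_eq_square algebra_simps)
  qed
  then show ?thesis using prod pos HF cl unfolding A by blast
qed

text \<open>Here the last coefficient of \<open>H\<close> is the one divisible by 3. A quarter turn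
  brings it to the front, where \<open>hessian_class_product\<close> applies, and a second one turns
  the resulting form back to the order of the given basis.\<close>

lemma half_trace_hessian_product_scale:
  assumes fund: "fundamental_discriminant D" and D3: "\<not> 3 dvd D" and D: "D = cubic_disc (a, b, c, d)"
    and H: "H = hessian (a, b, c, d)" and c: "[c = 0] (mod 3)"
    and C\<^sub>D: "([D = 0] (mod 4) \<and> C\<^sub>D = (3, 0, D div 4)) \<or> ([D = 1] (mod 4) \<and> C\<^sub>D = (3, 3, (D + 3) div 4))"
  shows "\<exists>q. (\<forall>x y. 3 * quad_eval q x y = quad_eval H (3 * x) y) \<and>
    q \<in> forms_of_disc (- 3 * D) \<and> C\<^sub>D \<in> forms_of_disc (- 3 * D) \<and> H \<in> forms_of_disc (- 3 * D) \<and>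
    form_class (- 3 * D) q \<otimes>\<^bsub>narrow_class_group (- 3 * D)\<^esub> form_class (- 3 * D) C\<^sub>D = form_class (- 3 * D) H"
proof -
  have HF: "H \<in> forms_of_disc (- 3 * D)" unfolding H by (rule hessian_in_forms_of_disc[OF fund D3 D])
  obtain P Q R where H': "H = (P, Q, R)" by (metis prod_cases3)
  have flip: "quad_subst (X, Y, Z) 0 (- 1) 1 0 = (Z, - Y, X)" for X Y Z by simp
  have "quad_subst H 0 (- 1) 1 0 \<in> forms_of_disc (- 3 * D)"
    by (rule quad_subst_in_forms_of_disc[OF fund D3 HF]) simp
  then have HF': "(R, - Q, P) \<in> forms_of_disc (- 3 * D)" unfolding H' flip .
  have "(H, (R, - Q, P)) \<in> sl2_rel (- 3 * D)"
    by (rule sl2_relI[OF HF HF', of 0 0 "- 1" 1]) (simp_all add: H')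
  then have cl: "form_class (- 3 * D) H = form_class (- 3 * D) (R, - Q, P)" by (rule form_class_eq)
  obtain k where k: "c = 3 * k" using c by (auto simp: cong_0_iff)
  have "R = 3 * (k * c - b * d)" using H' by (simp add: H k power2_eq_square algebra_simps)
  then obtain A where A: "R = A * 3" by (metis mult.commute)
  have pos: "A > 0" if "D > 0"
    using HF' that quad_pos_def_iff_first_coeff[of R "- Q" P] by (simp add: forms_of_disc_def A)
  have "quad_disc (A * 3, - Q, P) = - 3 * D" using HF' by (simp add: forms_of_disc_def A)
  note prod = hessian_class_product[OF fund D3 this _ C\<^sub>D]
  have qF: "(A, - Q, 3 * P) \<in> forms_of_disc (- 3 * D)" using prod pos by blast
  have "quad_subst (A, - Q, 3 * P) 0 (- 1) 1 0 \<in> forms_of_disc (- 3 * D)"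
    by (rule quad_subst_in_forms_of_disc[OF fund D3 qF]) simp
  then have qF': "(3 * P, Q, A) \<in> forms_of_disc (- 3 * D)" unfolding flip by simp
  have "((A, - Q, 3 * P), (3 * P, Q, A)) \<in> sl2_rel (- 3 * D)"
    by (rule sl2_relI[OF qF qF', of 0 0 "- 1" 1]) simp_all
  then have clq: "form_class (- 3 * D) (A, - Q, 3 * P) = form_class (- 3 * D) (3 * P, Q, A)"
    by (rule form_class_eq)
  have "3 * quad_eval (3 * P, Q, A) x y = quad_eval H (3 * x) y" for x y
    by (simp add: H' A power2_eq_square algebra_simps)
  then show ?thesis using prod pos HF qF' cl clq unfolding A by metis
qed

section \<open>Transport of the Delone-Faddeev basis along a Moebius map\<close>

text \<open>For the root \<open>t' = (p t + q) / (r t + s)\<close> of the transformed cubic, with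
  outer coefficients \<open>a'\<close> and \<open>d'\<close>, this expresses \<open>- a' t'\<close>
  and \<open>d' / t'\<close> through the same elements for \<open>t\<close>, up to sign.
  Denominators are cleared, so that the two sides differ by a multiple of the cubic at
  \<open>t\<close>; the factor \<open>- (a t\<^sup>2 + b t + c)\<close> is
  \<open>d / t\<close>.\<close>

lemma cubic_root_moebius:
  fixes t :: "'a::idom"
  assumes root: "a * t ^ 3 + b * t ^ 2 + c * t + d = 0"
    and \<delta>: "\<delta> = p * s - q * r"
  shows "- (a * s ^ 3 - b * s ^ 2 * r + c * s * r ^ 2 - d * r ^ 3) * (p * t + q)
      = (\<delta> * (s * (- a * t) - r * (- (a * t ^ 2 + b * t + c)))
         - (p * c * r * s - p * d * r ^ 2 + q * a * s ^ 2 - q * b * s * r)) * (r * t + s)" (is "?L1 = ?R1")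
    and "(- a * q ^ 3 + b * q ^ 2 * p - c * q * p ^ 2 + d * p ^ 3) * (r * t + s)
      = (\<delta> * (p * (- (a * t ^ 2 + b * t + c)) - q * (- a * t))
         + (s * b * q * p - s * a * q ^ 2 + r * d * p ^ 2 - r * c * p * q)) * (p * t + q)" (is "?L2 = ?R2")
proof -
  have "?L1 - ?R1 = - \<delta> * r ^ 2 * (a * t ^ 3 + b * t ^ 2 + c * t + d)"
    "?L2 - ?R2 = \<delta> * p ^ 2 * (a * t ^ 3 + b * t ^ 2 + c * t + d)"
    by (simp_all add: \<delta> power2_eq_square power3_eq_cube algebra_simps)
  then show "?L1 = ?R1" "?L2 = ?R2" unfolding root by simp_all
qed

text \<open>The root \<open>\<theta>\<close> of the given form is sent to a root
  \<open>\<theta>\<^sub>0\<close> of the form \<open>F0\<close> whose basis is known; the two bases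
  then differ by an integral matrix of determinant 1 or -1 and integer shifts.\<close>

lemma delone_faddeev_class_basis:
  fixes K :: "'a::field_char_0 set"
  assumes K: "is_subfield K" and DF: "in_delone_faddeev_class K (a, b, c, d)"
    and \<theta>: "\<theta> \<in> K" "cubic_eval (a, b, c, d) \<theta> 1 = 0"
  shows "\<theta> \<noteq> 0" "int_basis [1, - of_int a * \<theta>, of_int d / \<theta>] (ring_of_integers K)"
proof -
  obtain F0 where "delone_faddeev_form K F0" "gl2_equiv F0 (a, b, c, d)"
    using DF unfolding in_delone_faddeev_class_def by blast
  moreover obtain a0 b0 c0 d0 where F0: "F0 = (a0, b0, c0, d0)" by (metis prod_cases4)
  ultimately obtain p q r s :: int where det: "\<bar>p * s - q * r\<bar> = 1"
    and e: "\<And>x y :: int. cubic_eval (a, b, c, d) x y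
      = cubic_eval (a0, b0, c0, d0) (p * x + q * y) (r * x + s * y)"
    and df: "delone_faddeev_form K (a0, b0, c0, d0)"
    unfolding gl2_equiv_def by blast
  have basis: "int_basis [1, - of_int a0 * t, of_int d0 / t] (ring_of_integers K)"
    if "t \<in> K" "cubic_eval (a0, b0, c0, d0) t 1 = 0" for t
    using df that by (simp add: delone_faddeev_form_def)
  obtain t where t: "t \<in> K" "cubic_eval (a0, b0, c0, d0) t 1 = 0"
    using df by (auto simp: delone_faddeev_form_def)
  have ind: "k = 0 \<and> l = 0 \<and> m = 0"
    if "t \<in> K" "cubic_eval (a0, b0, c0, d0) t 1 = 0"
      "of_int k * 1 + of_int l * (- of_int a0 * t) + of_int m * (of_int d0 / t) = 0" for k l m t
    using basis[OF that(1,2)] that(3) unfolding int_basis_3_iff by blast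
  have a0: "a0 \<noteq> 0" using ind[OF t, of 0 1 0] by auto
  \<comment> \<open>No root is rational: \<open>a0\<close> times a relation
    \<open>k * t + l = 0\<close> is an integral relation between the basis elements \<open>1\<close>
    and \<open>- a0 * t\<close>.\<close>
  have irrat: "of_int k * t + of_int l \<noteq> 0 \<or> (k = 0 \<and> l = 0)"
    if "t \<in> K" "cubic_eval (a0, b0, c0, d0) t 1 = 0" for t k l
  proof (rule disjCI)
    assume "\<not> (k = 0 \<and> l = 0)"
    show "of_int k * t + of_int l \<noteq> 0"
    proof
      assume z: "of_int k * t + of_int l = 0"
      have "of_int (a0 * l) * 1 + of_int (- k) * (- of_int a0 * t) + of_int 0 * (of_int d0 / t)
        = of_int a0 * (of_int k * t + of_int l)"
        by (simp add: algebra_simps)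
      then have "of_int (a0 * l) * 1 + of_int (- k) * (- of_int a0 * t) + of_int 0 * (of_int d0 / t) = 0"
        unfolding z by simp
      from ind[OF that this] show False using a0 \<open>\<not> (k = 0 \<and> l = 0)\<close> by auto
    qed
  qed
  define \<delta> where "\<delta> = p * s - q * r"
  have \<delta>: "\<delta> * \<delta> = 1" using det by (metis \<delta>_def abs_mult_self_eq mult_1)
  define X Y where "X = of_int p * \<theta> + of_int q" and "Y = of_int r * \<theta> + of_int s"
  have XY: "cubic_eval (a0, b0, c0, d0) X Y = 0"
    using cubic_eval_subst[OF e, of \<theta> 1] \<theta>(2) by (simp only: X_def Y_def mult_1_right)
  have nz: "Y \<noteq> 0"
  proof
    assume Y: "Y = 0"
    then have "X = 0" using XY a0 by simp
    have "of_int \<delta> = of_int p * Y - of_int r * X"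
      by (simp add: \<delta>_def X_def Y_def algebra_simps)
    then show False using Y \<open>X = 0\<close> \<delta> by simp
  qed
  define \<theta>\<^sub>0 where "\<theta>\<^sub>0 = X / Y"
  have "\<theta>\<^sub>0 \<in> K"
    unfolding \<theta>\<^sub>0_def X_def Y_def
    by (rule subfield_divide[OF K] subfield_add[OF K] subfield_mult[OF K] subfield_of_int[OF K] \<theta>(1))+
  moreover have root0: "cubic_eval (a0, b0, c0, d0) \<theta>\<^sub>0 1 = 0"
  proof -
    have "cubic_eval (a0, b0, c0, d0) \<theta>\<^sub>0 1 * Y ^ 3 = cubic_eval (a0, b0, c0, d0) X Y"
      using nz by (simp add: \<theta>\<^sub>0_def field_simps power2_eq_square power3_eq_cube)
    then show ?thesis using XY nz by simp
  qed
  ultimately have \<theta>\<^sub>0: "\<theta>\<^sub>0 \<in> K" "cubic_eval (a0, b0, c0, d0) \<theta>\<^sub>0 1 = 0" by simp_all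
  have "X \<noteq> 0" using irrat[OF \<theta>\<^sub>0, of 1 0] by (auto simp: \<theta>\<^sub>0_def)
  show "\<theta> \<noteq> 0"
  proof
    assume "\<theta> = 0"
    then have "\<theta>\<^sub>0 * of_int s = of_int q" "of_int s \<noteq> (0 :: 'a)" using nz by (auto simp: \<theta>\<^sub>0_def X_def Y_def)
    then show False using irrat[OF \<theta>\<^sub>0, of s "- q"] by (simp add: mult.commute)
  qed
  let ?a = "of_int a :: 'a" and ?b = "of_int b :: 'a" and ?c = "of_int c :: 'a" and ?d = "of_int d :: 'a"
  have root: "?a * \<theta> ^ 3 + ?b * \<theta> ^ 2 + ?c * \<theta> + ?d = 0" using \<theta>(2) by simp
  then have "?d = - (?a * \<theta> ^ 2 + ?b * \<theta> + ?c) * \<theta>"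
    by (simp add: power2_eq_square power3_eq_cube algebra_simps eq_neg_iff_add_eq_0)
  then have \<beta>: "?d / \<theta> = - (?a * \<theta> ^ 2 + ?b * \<theta> + ?c)" using \<open>\<theta> \<noteq> 0\<close> by simp
  note moebius = cubic_root_moebius[OF root refl, where p = "of_int p" and q = "of_int q" and r = "of_int r" and s = "of_int s",
      folded \<beta> X_def Y_def]
  have cube: "\<delta> ^ 3 = \<delta>" using \<delta> by (simp add: power3_eq_cube)
  \<comment> \<open>\<open>ea\<close> and \<open>ed\<close> are the values of the given form at
    \<open>(s, - r)\<close> and \<open>(- q, p)\<close>. The substitution sends these points to
    \<open>(\<delta>, 0)\<close> and \<open>(0, \<delta>)\<close>, so they equal \<open>a0\<close>
    and \<open>d0\<close> up to the sign \<open>\<delta>\<close>.\<close>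
  define ea where "ea = a * s ^ 3 - b * s ^ 2 * r + c * s * r ^ 2 - d * r ^ 3"
  define ed where "ed = - a * q ^ 3 + b * q ^ 2 * p - c * q * p ^ 2 + d * p ^ 3"
  have "- ea = - (a0 * \<delta> ^ 3)"
    using e[of "- s" r] by (simp add: ea_def \<delta>_def power3_eq_cube algebra_simps)
  then have a0': "a0 = \<delta> * ea" unfolding cube using \<delta> by (simp add: mult_ac)
  have "ed = d0 * \<delta> ^ 3"
    using e[of "- q" p] by (simp add: ed_def \<delta>_def power3_eq_cube algebra_simps)
  then have d0': "d0 = \<delta> * ed" unfolding cube using \<delta> by (simp add: mult_ac)
  define k where "k = p * c * r * s - p * d * r ^ 2 + q * a * s ^ 2 - q * b * s * r"
  define k' where "k' = s * b * q * p - s * a * q ^ 2 + r * d * p ^ 2 - r * c * p * q"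
  have \<delta>': "of_int \<delta> * of_int \<delta> = (1 :: 'a)" using \<delta> by (metis of_int_1 of_int_mult)
  let ?\<alpha> = "- of_int a * \<theta>" and ?\<beta> = "of_int d / \<theta>"
  have m1: "- of_int ea * X = (of_int \<delta> * (of_int s * ?\<alpha> - of_int r * ?\<beta>) - of_int k) * Y"
    using moebius(1) unfolding ea_def \<delta>_def k_def of_int_add of_int_diff of_int_mult of_int_power .
  have m2: "of_int ed * Y = (of_int \<delta> * (of_int p * ?\<beta> - of_int q * ?\<alpha>) + of_int k') * X"
    using moebius(2) unfolding ed_def \<delta>_def k'_def of_int_add of_int_diff of_int_mult of_int_power of_int_minus .
  have "- of_int a0 * \<theta>\<^sub>0 = of_int \<delta> * ((- of_int ea * X) / Y)"
    by (simp add: a0' \<theta>\<^sub>0_def)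
  also have "\<dots> = of_int \<delta> * (of_int \<delta> * (of_int s * ?\<alpha> - of_int r * ?\<beta>) - of_int k)"
    unfolding m1 using nz by simp
  also have "\<dots> = of_int s * ?\<alpha> - of_int r * ?\<beta> + of_int (- \<delta> * k)"
    using \<delta>' by (simp only: right_diff_distrib[of "of_int \<delta>"] mult.assoc[symmetric]) simp
  finally have 1: "- of_int a0 * \<theta>\<^sub>0 = of_int s * ?\<alpha> - of_int r * ?\<beta> + of_int (- \<delta> * k)" .
  have "of_int d0 / \<theta>\<^sub>0 = of_int \<delta> * ((of_int ed * Y) / X)"
    by (simp add: d0' \<theta>\<^sub>0_def)
  also have "\<dots> = of_int \<delta> * (of_int \<delta> * (of_int p * ?\<beta> - of_int q * ?\<alpha>) + of_int k')"
    unfolding m2 using \<open>X \<noteq> 0\<close> by simp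
  also have "\<dots> = of_int p * ?\<beta> - of_int q * ?\<alpha> + of_int (\<delta> * k')"
    using \<delta>' by (simp only: distrib_left[of "of_int \<delta>"] mult.assoc[symmetric]) simp
  finally have 2: "of_int d0 / \<theta>\<^sub>0 = of_int p * ?\<beta> - of_int q * ?\<alpha> + of_int (\<delta> * k')" .
  show "int_basis [1, ?\<alpha>, ?\<beta>] (ring_of_integers K)"
    by (rule int_basis_unimodular[OF basis[OF \<theta>\<^sub>0] \<delta>_def[symmetric] \<delta> 1 2])
qed

section \<open>The trace form of a cubic ring\<close>

text \<open>The three products are the multiplication table of the cubic ring that Delone and
  Faddeev attach to \<open>(a, b, c, d)\<close>, normalised so that
  \<open>\<alpha> * \<beta>\<close> is an integer. The root is forgotten; everything below follows
  from the table.\<close>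

locale cubic_order_basis =
  fixes K :: "'a::field_char_0 set" and a b c d :: int and \<alpha> \<beta> :: 'a
  assumes cubic: "cubic_field K"
    and basis: "int_basis [1, \<alpha>, \<beta>] (ring_of_integers K)"
    and \<alpha>\<alpha>: "\<alpha> * \<alpha> = - (of_int a * of_int c) + of_int b * \<alpha> - of_int a * \<beta>"
    and \<alpha>\<beta>: "\<alpha> * \<beta> = - (of_int a * of_int d)"
    and \<beta>\<beta>: "\<beta> * \<beta> = - (of_int b * of_int d) + of_int d * \<alpha> - of_int c * \<beta>"
begin

lemma subfield: "is_subfield K" and dim: "ratvs.dim K = 3"
  using cubic by (auto simp: number_field_deg_def)

lemma ring_of_integers_eq:
  "ring_of_integers K = {of_int k * 1 + of_int l * \<alpha> + of_int m * \<beta> | k l m. True}"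
  using basis[unfolded int_basis_3_iff] by (rule conjunct2)

lemma basis_independent:
  "of_int k + of_int l * \<alpha> + of_int m * \<beta> = 0 \<Longrightarrow> k = 0 \<and> l = 0 \<and> m = 0"
  using conjunct1[OF basis[unfolded int_basis_3_iff], rule_format, of k l m] by simp

lemma basis_in_ring: "set [1, \<alpha>, \<beta>] \<subseteq> ring_of_integers K"
  using basis intmod.span_superset[of "set [1, \<alpha>, \<beta>]"] by (simp add: int_basis_def)

lemma basis_in_field: "1 \<in> K" "\<alpha> \<in> K" "\<beta> \<in> K"
  using basis_in_ring by (auto simp: ring_of_integers_def)

lemma rat_basis:
  shows "distinct [1, \<alpha>, \<beta>]" and "ratvs.independent (set [1, \<alpha>, \<beta>])"
    and "ratvs.span (set [1, \<alpha>, \<beta>]) = K"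
proof -
  show d: "distinct [1, \<alpha>, \<beta>]" and i: "ratvs.independent (set [1, \<alpha>, \<beta>])"
    using basis int_independent_imp_rat_independent unfolding int_basis_def by blast+
  have "card (set [1, \<alpha>, \<beta>]) = 3" using distinct_card[OF d] by simp
  then show "ratvs.span (set [1, \<alpha>, \<beta>]) = K"
    using rat_span_eq_if_card_eq_dim[OF subfield_subspace[OF subfield] i] basis_in_field dim by simp
qed

lemma field_subset_span: "K \<subseteq> ratvs.span (ring_of_integers K)"
  using rat_basis(3) ratvs.span_mono[OF basis_in_ring] by blast

lemma combination_in_field: "of_rat r + of_rat s * \<alpha> + of_rat t * \<beta> \<in> K"
  using basis_in_field
  by (intro subfield_add[OF subfield] subfield_mult[OF subfield] subfield_of_rat[OF subfield]) auto

lemma field_trace_eq: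
  "field_trace K (of_rat r + of_rat s * \<alpha> + of_rat t * \<beta>) = 3 * r + of_int b * s - of_int c * t"
proof -
  let ?x = "of_rat r + of_rat s * \<alpha> + of_rat t * \<beta>"
  \<comment> \<open>Row \<open>i\<close> holds the coordinates of \<open>?x\<close> times the
    \<open>i\<close>-th basis element; the diagonal is \<open>r\<close>, \<open>r + b s\<close>,
    \<open>r - c t\<close>.\<close>
  define A where "A i j = (
    [[r, s, t],
     [- (of_int a * of_int c) * s - of_int a * of_int d * t, r + of_int b * s, - of_int a * s],
     [- (of_int a * of_int d) * s - of_int b * of_int d * t, of_int d * t, r - of_int c * t]] ! i) ! j"
    for i j :: nat
  have e: "(\<Sum>j<length [1, \<alpha>, \<beta>]. of_rat (f j) * [1, \<alpha>, \<beta>] ! j)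
    = of_rat (f 0) + of_rat (f 1) * \<alpha> + of_rat (f 2) * \<beta>" for f
    by (simp add: numeral_3_eq_3 numeral_2_eq_2)
  have x\<alpha>: "?x * \<alpha> = of_rat r * \<alpha> + of_rat s * (\<alpha> * \<alpha>) + of_rat t * (\<alpha> * \<beta>)"
    and x\<beta>: "?x * \<beta> = of_rat r * \<beta> + of_rat s * (\<alpha> * \<beta>) + of_rat t * (\<beta> * \<beta>)"
    by (simp_all add: algebra_simps)
  have "field_trace K ?x = (\<Sum>i<length [1, \<alpha>, \<beta>]. A i i)"
  proof (rule field_trace_eq_matrix_trace[where A = A, OF subfield rat_basis combination_in_field])
    fix i assume "i < length [1, \<alpha>, \<beta>]"
    then consider "i = 0" | "i = 1" | "i = 2" by fastforce
    then show "?x * [1, \<alpha>, \<beta>] ! i = (\<Sum>j<length [1, \<alpha>, \<beta>]. of_rat (A i j) * [1, \<alpha>, \<beta>] ! j)"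
    proof cases
      case 1
      then show ?thesis unfolding e by (simp add: A_def)
    next
      case 2
      have "?x * \<alpha> = of_rat (A 1 0) + of_rat (A 1 1) * \<alpha> + of_rat (A 1 2) * \<beta>"
        unfolding x\<alpha> \<alpha>\<alpha> \<alpha>\<beta> by (simp add: A_def of_rat_add of_rat_diff of_rat_mult of_rat_minus algebra_simps)
      then show ?thesis unfolding e 2 by simp
    next
      case 3
      have "?x * \<beta> = of_rat (A 2 0) + of_rat (A 2 1) * \<alpha> + of_rat (A 2 2) * \<beta>"
        unfolding x\<beta> \<beta>\<beta> \<alpha>\<beta>
        by (simp add: A_def of_rat_add of_rat_diff of_rat_mult of_rat_minus numeral_2_eq_2 algebra_simps)
      then show ?thesis unfolding e 3 by (simp add: numeral_2_eq_2)
    qed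
  qed
  also have "\<dots> = 3 * r + of_int b * s - of_int c * t"
    by (simp add: A_def numeral_3_eq_3)
  finally show ?thesis .
qed

lemma field_trace_basis:
  shows "field_trace K 1 = 3" "field_trace K \<alpha> = of_int b" "field_trace K \<beta> = - of_int c"
  using field_trace_eq[of 1 0 0] field_trace_eq[of 0 1 0] field_trace_eq[of 0 0 1] by simp_all

lemma field_trace_products:
  shows "field_trace K (\<alpha> * \<alpha>) = of_int (b ^ 2 - 2 * a * c)"
    and "field_trace K (\<alpha> * \<beta>) = of_int (- 3 * a * d)"
    and "field_trace K (\<beta> * \<beta>) = of_int (c ^ 2 - 2 * b * d)"
proof -
  have "\<alpha> * \<alpha> = of_rat (of_int (- (a * c))) + of_rat (of_int b) * \<alpha> + of_rat (of_int (- a)) * \<beta>"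
    "\<alpha> * \<beta> = of_rat (of_int (- (a * d))) + of_rat 0 * \<alpha> + of_rat 0 * \<beta>"
    "\<beta> * \<beta> = of_rat (of_int (- (b * d))) + of_rat (of_int d) * \<alpha> + of_rat (of_int (- c)) * \<beta>"
    unfolding \<alpha>\<alpha> \<alpha>\<beta> \<beta>\<beta> of_rat_of_int_eq by simp_all
  then show "field_trace K (\<alpha> * \<alpha>) = of_int (b ^ 2 - 2 * a * c)"
    "field_trace K (\<alpha> * \<beta>) = of_int (- 3 * a * d)" "field_trace K (\<beta> * \<beta>) = of_int (c ^ 2 - 2 * b * d)"
    by (simp_all only: field_trace_eq) (simp_all add: power2_eq_square)
qed

lemma gram_det_basis:
  "Determinant.det (mat 3 3 (\<lambda>(i, j). field_trace K ([1, \<alpha>, \<beta>] ! i * [1, \<alpha>, \<beta>] ! j)))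
    = of_int (cubic_disc (a, b, c, d))"
proof -
  have "field_trace K (\<beta> * \<alpha>) = of_int (- 3 * a * d)"
    by (subst mult.commute) (rule field_trace_products)
  then show ?thesis
    unfolding det_3_mat
    by (simp add: field_trace_basis field_trace_products numeral_2_eq_2[symmetric])
      (simp add: power2_eq_square power3_eq_cube algebra_simps)
qed

text \<open>Each of the two values is an integral square times the other, so for nonzero
  \<open>D\<close> the square is a unit, hence 1.\<close>

lemma discriminant_unique:
  assumes D: "has_discriminant K D" and "D \<noteq> 0"
  shows "D = cubic_disc (a, b, c, d)"
proof -
  let ?E = "cubic_disc (a, b, c, d)"
  have E: "has_discriminant K ?E"
    unfolding has_discriminant_def
    by (intro exI[of _ "[1, \<alpha>, \<beta>]"] conjI basis) (simp add: gram_det_basis[unfolded numeral_3_eq_3] numeral_3_eq_3)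
  obtain m :: int where m: "?E = m ^ 2 * D"
    using gram_det_eq_square_mult_discriminant[OF cubic D field_subset_span _ basis_in_ring]
    unfolding gram_det_basis of_int_eq_iff by auto
  obtain ws where ws: "int_basis ws (ring_of_integers K)" and
    wsD: "of_int D = Determinant.det (mat (length ws) (length ws) (\<lambda>(i, j). field_trace K (ws ! i * ws ! j)))"
    using D unfolding has_discriminant_def by blast
  have l: "length ws = 3" using int_basis_imp_rat_basis(4)[OF cubic ws field_subset_span] .
  have "set ws \<subseteq> ring_of_integers K"
    using ws intmod.span_superset[of "set ws"] by (auto simp: int_basis_def)
  from gram_det_eq_square_mult_discriminant[OF cubic E field_subset_span l this]
  obtain n :: int where n: "D = n ^ 2 * ?E"
    using wsD unfolding l by (metis of_int_eq_iff)
  have "D * (n ^ 2 * m ^ 2) = n ^ 2 * (m ^ 2 * D)" by (simp only: mult_ac)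
  also have "\<dots> = D * 1" by (simp only: m[symmetric] n[symmetric] mult_1_right)
  finally have "m ^ 2 * n ^ 2 = 1" using \<open>D \<noteq> 0\<close> by (metis mult_cancel_left mult.commute)
  then have "m ^ 2 dvd 1" by (metis dvd_triv_left)
  then have "m ^ 2 = 1" by (simp add: power2_eq_1_iff abs_eq_iff')
  then show ?thesis using m by simp
qed

definition "\<alpha>\<^sub>0 = \<alpha> - of_rat (field_trace K \<alpha> / 3)"
definition "\<beta>\<^sub>0 = \<beta> - of_rat (field_trace K \<beta> / 3)"

lemma \<alpha>\<^sub>0: "\<alpha>\<^sub>0 = \<alpha> - of_int b / 3" and \<beta>\<^sub>0: "\<beta>\<^sub>0 = \<beta> + of_int c / 3"
  by (simp_all add: \<alpha>\<^sub>0_def \<beta>\<^sub>0_def field_trace_basis of_rat_divide of_rat_minus)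

lemma half_trace_square:
  "field_trace K ((of_int x * \<alpha>\<^sub>0 + of_int y * \<beta>\<^sub>0) ^ 2) / 2
    = of_int (quad_eval (hessian (a, b, c, d)) x y) / 3"
proof -
  let ?x = "of_int x :: rat" and ?y = "of_int y :: rat"
  let ?a = "of_int a :: rat" and ?b = "of_int b :: rat" and ?c = "of_int c :: rat" and ?d = "of_int d :: rat"
  \<comment> \<open>The three products are brought into the basis
    \<open>1, \<alpha>, \<beta>\<close>, where \<open>field_trace_eq\<close> gives their
    traces.\<close>
  have "\<alpha>\<^sub>0 * \<alpha>\<^sub>0 = of_rat (?b ^ 2 / 9 - ?a * ?c) + of_rat (?b / 3) * \<alpha> + of_rat (- ?a) * \<beta>"
    (is "_ = ?aa")
  proof -
    have "\<alpha>\<^sub>0 * \<alpha>\<^sub>0 = \<alpha> * \<alpha> - 2 * (of_int b / 3) * \<alpha> + of_int b ^ 2 / 9"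
      by (simp add: \<alpha>\<^sub>0 power2_eq_square field_simps)
    then show ?thesis
      unfolding \<alpha>\<alpha> by (simp add: of_rat_diff of_rat_divide of_rat_mult of_rat_power of_rat_minus field_simps)
  qed
  moreover have "\<alpha>\<^sub>0 * \<beta>\<^sub>0 = of_rat (- ?a * ?d - ?b * ?c / 9) + of_rat (?c / 3) * \<alpha> + of_rat (- (?b / 3)) * \<beta>"
    (is "_ = ?ab")
  proof -
    have "\<alpha>\<^sub>0 * \<beta>\<^sub>0 = \<alpha> * \<beta> + of_int c / 3 * \<alpha> - of_int b / 3 * \<beta> - of_int b * of_int c / 9"
      by (simp add: \<alpha>\<^sub>0 \<beta>\<^sub>0 field_simps)
    then show ?thesis
      unfolding \<alpha>\<beta> by (simp add: of_rat_diff of_rat_divide of_rat_mult of_rat_minus)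
  qed
  moreover have "\<beta>\<^sub>0 * \<beta>\<^sub>0 = of_rat (?c ^ 2 / 9 - ?b * ?d) + of_rat ?d * \<alpha> + of_rat (- (?c / 3)) * \<beta>"
    (is "_ = ?bb")
  proof -
    have "\<beta>\<^sub>0 * \<beta>\<^sub>0 = \<beta> * \<beta> + (of_int c - of_int c / 3) * \<beta> + of_int c ^ 2 / 9"
      by (simp add: \<beta>\<^sub>0 power2_eq_square field_simps)
    then show ?thesis
      unfolding \<beta>\<beta> left_diff_distrib
      by (simp add: of_rat_diff of_rat_divide of_rat_mult of_rat_power of_rat_minus)
  qed
  moreover have "(of_int x * \<alpha>\<^sub>0 + of_int y * \<beta>\<^sub>0) ^ 2 = of_rat (?x ^ 2) * (\<alpha>\<^sub>0 * \<alpha>\<^sub>0)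
      + of_rat (2 * ?x * ?y) * (\<alpha>\<^sub>0 * \<beta>\<^sub>0) + of_rat (?y ^ 2) * (\<beta>\<^sub>0 * \<beta>\<^sub>0)"
    by (simp add: of_rat_mult of_rat_power power2_eq_square algebra_simps)
  ultimately have sq: "(of_int x * \<alpha>\<^sub>0 + of_int y * \<beta>\<^sub>0) ^ 2
    = of_rat (?x ^ 2) * ?aa + of_rat (2 * ?x * ?y) * ?ab + of_rat (?y ^ 2) * ?bb"
    by (simp only:)
  have scaled: "of_rat q * (of_rat r + of_rat s * \<alpha> + of_rat t * \<beta>) \<in> K" for q r s t
    by (intro subfield_mult[OF subfield] subfield_of_rat[OF subfield] combination_in_field)
  have "field_trace K ((of_int x * \<alpha>\<^sub>0 + of_int y * \<beta>\<^sub>0) ^ 2)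
    = ?x ^ 2 * field_trace K ?aa + 2 * ?x * ?y * field_trace K ?ab + ?y ^ 2 * field_trace K ?bb"
    unfolding sq using scaled combination_in_field
    by (simp only: field_trace_add[OF subfield] field_trace_scale[OF subfield] subfield_add[OF subfield])
  then show ?thesis
    unfolding field_trace_eq by (simp add: power2_eq_square field_simps)
qed

text \<open>The trace of \<open>k + m \<alpha> + n \<beta>\<close> is
  \<open>3 k + m b - n c\<close>. Vanishing determines \<open>k\<close> and requires the
  divisibility; this \<open>k\<close> is exactly what passing from \<open>\<alpha>, \<beta>\<close>
  to \<open>\<alpha>\<^sub>0, \<beta>\<^sub>0\<close> absorbs.\<close>

lemma trace_zero_integers_eq:
  "trace_zero_integers K = {of_int m * \<alpha>\<^sub>0 + of_int n * \<beta>\<^sub>0 | m n. 3 dvd m * b - n * c}"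
proof (intro equalityI subsetI)
  fix x assume "x \<in> trace_zero_integers K"
  then have x: "x \<in> ring_of_integers K" "field_trace K x = 0" by (simp_all add: trace_zero_integers_def)
  then obtain k m n where kmn: "x = of_int k * 1 + of_int m * \<alpha> + of_int n * \<beta>"
    unfolding ring_of_integers_eq by blast
  then have "field_trace K x = of_int (3 * k + m * b - n * c)"
    using field_trace_eq[of "of_int k" "of_int m" "of_int n"] by (simp add: mult.commute)
  then have k: "3 * k + m * b - n * c = 0" using x(2) by (metis of_int_eq_0_iff)
  then have k3: "m * b - n * c = 3 * (- k)" by simp
  have "of_int (m * b - n * c) = (of_int (3 * (- k)) :: 'a)" unfolding k3 ..
  then have "of_int m * of_int b / 3 - of_int n * of_int c / 3 = (- of_int k :: 'a)"
    by (simp flip: diff_divide_distrib)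
  then have "x = of_int m * \<alpha>\<^sub>0 + of_int n * \<beta>\<^sub>0"
    unfolding kmn \<alpha>\<^sub>0 \<beta>\<^sub>0 by (simp add: algebra_simps)
  then show "x \<in> {of_int m * \<alpha>\<^sub>0 + of_int n * \<beta>\<^sub>0 | m n. 3 dvd m * b - n * c}"
    using k3 by (metis (mono_tags, lifting) dvd_triv_left mem_Collect_eq)
next
  fix x assume "x \<in> {of_int m * \<alpha>\<^sub>0 + of_int n * \<beta>\<^sub>0 | m n. 3 dvd m * b - n * c}"
  then obtain m n k where x: "x = of_int m * \<alpha>\<^sub>0 + of_int n * \<beta>\<^sub>0" and k: "m * b - n * c = 3 * k"
    by (auto elim: dvdE)
  have "of_int (m * b - n * c) = (of_int (3 * k) :: 'a)" unfolding k ..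
  then have x': "x = of_int (- k) * 1 + of_int m * \<alpha> + of_int n * \<beta>"
    by (simp add: x \<alpha>\<^sub>0 \<beta>\<^sub>0 field_simps)
  then have "x \<in> ring_of_integers K" unfolding ring_of_integers_eq by blast
  have "field_trace K x = of_int (3 * (- k) + m * b - n * c)"
    using field_trace_eq[of "of_int (- k)" "of_int m" "of_int n"]
    unfolding x' of_rat_of_int_eq mult_1_right by (simp add: mult.commute)
  moreover have "3 * (- k) + m * b - n * c = 0" using k by simp
  ultimately have "field_trace K x = 0" by (simp only: of_int_0)
  with \<open>x \<in> ring_of_integers K\<close> show "x \<in> trace_zero_integers K" by (simp add: trace_zero_integers_def)
qed

text \<open>Reduces the basis claim to integer coordinates: \<open>(i, j)\<close> and
  \<open>(k, l)\<close> have to generate the lattice of all \<open>(m, n)\<close> with 3 dividing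
  \<open>m * b - n * c\<close>.\<close>

lemma int_basis_trace_zero_integers:
  assumes det: "i * l - j * k \<noteq> 0"
    and lattice: "\<And>m n. 3 dvd m * b - n * c \<longleftrightarrow> (\<exists>x y. m = i * x + k * y \<and> n = j * x + l * y)"
  shows "int_basis [of_int i * \<alpha>\<^sub>0 + of_int j * \<beta>\<^sub>0, of_int k * \<alpha>\<^sub>0 + of_int l * \<beta>\<^sub>0] (trace_zero_integers K)"
proof -
  let ?u = "of_int i * \<alpha>\<^sub>0 + of_int j * \<beta>\<^sub>0" and ?v = "of_int k * \<alpha>\<^sub>0 + of_int l * \<beta>\<^sub>0"
  have e: "of_int x * ?u + of_int y * ?v = of_int (i * x + k * y) * \<alpha>\<^sub>0 + of_int (j * x + l * y) * \<beta>\<^sub>0" for x y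
    by (simp add: algebra_simps)
  have ind: "m = 0 \<and> n = 0" if "of_int m * \<alpha>\<^sub>0 + of_int n * \<beta>\<^sub>0 = 0" for m n
  proof -
    have "of_int (n * c - m * b) + of_int (3 * m) * \<alpha> + of_int (3 * n) * \<beta>
      = 3 * (of_int m * \<alpha>\<^sub>0 + of_int n * \<beta>\<^sub>0)"
      by (simp add: \<alpha>\<^sub>0 \<beta>\<^sub>0 field_simps)
    then have "of_int (n * c - m * b) + of_int (3 * m) * \<alpha> + of_int (3 * n) * \<beta> = 0"
      unfolding that by simp
    from basis_independent[OF this] show ?thesis by simp
  qed
  show ?thesis
    unfolding int_basis_2_iff e
  proof (intro conjI allI impI)
    fix x y assume "of_int (i * x + k * y) * \<alpha>\<^sub>0 + of_int (j * x + l * y) * \<beta>\<^sub>0 = 0"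
    then have z: "i * x + k * y = 0" "j * x + l * y = 0" using ind by blast+
    have "(i * l - j * k) * x = l * (i * x + k * y) - k * (j * x + l * y)"
      "(i * l - j * k) * y = i * (j * x + l * y) - j * (i * x + k * y)"
      by (simp_all add: algebra_simps)
    then have "(i * l - j * k) * x = 0" "(i * l - j * k) * y = 0" unfolding z by simp_all
    then show "x = 0" "y = 0" using det by (metis mult_eq_0_iff)+
  next
    show "trace_zero_integers K
      = {of_int (i * x + k * y) * \<alpha>\<^sub>0 + of_int (j * x + l * y) * \<beta>\<^sub>0 | x y. True}"
      unfolding trace_zero_integers_eq lattice by blast
  qed
qed

end

lemma cubic_order_basis_root:
  fixes K :: "'a::field_char_0 set"
  assumes "cubic_field K" "in_delone_faddeev_class K (a, b, c, d)"
    and \<theta>: "\<theta> \<in> K" "cubic_eval (a, b, c, d) \<theta> 1 = 0"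
  shows "cubic_order_basis K a b c d (- of_int a * \<theta>) (of_int d / \<theta>)"
proof -
  have "is_subfield K" using assms(1) by (simp add: number_field_deg_def)
  note b = delone_faddeev_class_basis[OF this assms(2) \<theta>]
  have "of_int a * \<theta> ^ 3 + of_int b * \<theta> ^ 2 + of_int c * \<theta> + of_int d = 0" using \<theta>(2) by simp
  then have d: "of_int d = - (of_int a * \<theta> ^ 2 + of_int b * \<theta> + of_int c) * \<theta>"
    by (simp add: power2_eq_square power3_eq_cube algebra_simps eq_neg_iff_add_eq_0)
  then have \<beta>: "of_int d / \<theta> = - (of_int a * \<theta> ^ 2 + of_int b * \<theta> + of_int c)" using b(1) by simp
  show ?thesis
  proof
    show "cubic_field K" "int_basis [1, - of_int a * \<theta>, of_int d / \<theta>] (ring_of_integers K)"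
      using assms(1) b(2) by simp_all
    show "(- of_int a * \<theta>) * (- of_int a * \<theta>) = - (of_int a * of_int c) + of_int b * (- of_int a * \<theta>)
      - of_int a * (of_int d / \<theta>)"
      unfolding \<beta> by (simp add: power2_eq_square algebra_simps)
    show "(- of_int a * \<theta>) * (of_int d / \<theta>) = - (of_int a * of_int d)" using b(1) by simp
    have "of_int d / \<theta> * (of_int d / \<theta>) = of_int d / \<theta> * - (of_int a * \<theta> ^ 2 + of_int b * \<theta> + of_int c)"
      unfolding \<beta> ..
    also have "\<dots> = - (of_int b * of_int d) + of_int d * (- of_int a * \<theta>) - of_int c * (of_int d / \<theta>)"
      using b(1) by (simp add: field_simps power2_eq_square)
    finally show "of_int d / \<theta> * (of_int d / \<theta>)
      = - (of_int b * of_int d) + of_int d * (- of_int a * \<theta>) - of_int c * (of_int d / \<theta>)" .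
  qed
qed

theorem theorem5p5:
  fixes K :: "'a::field_char_0 set" and d\<^sub>K a b c d :: int
    and \<theta> \<alpha> \<beta> \<alpha>\<^sub>0 \<beta>\<^sub>0 u v :: 'a and C H :: quad_form
  assumes "cubic_field K"
    and "has_discriminant K d\<^sub>K"
    and "fundamental_discriminant d\<^sub>K"
    and "\<not> 3 dvd d\<^sub>K"
    and "in_delone_faddeev_class K (a, b, c, d)"
    and "\<theta> \<in> K" and "cubic_eval (a, b, c, d) \<theta> 1 = 0"
    and "\<alpha> = - of_int a * \<theta>" and "\<beta> = of_int d / \<theta>"
    and "\<alpha>\<^sub>0 = \<alpha> - of_rat (field_trace K \<alpha> / 3)"
    and "\<beta>\<^sub>0 = \<beta> - of_rat (field_trace K \<beta> / 3)"
    and "H = hessian (a, b, c, d)"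
    and "([b = 0] (mod 3) \<and> (u, v) = (\<alpha>\<^sub>0, 3 * \<beta>\<^sub>0)) \<or>
         ([c = 0] (mod 3) \<and> (u, v) = (3 * \<alpha>\<^sub>0, \<beta>\<^sub>0)) \<or>
         ([b = - c] (mod 3) \<and> (u, v) = (\<alpha>\<^sub>0 - \<beta>\<^sub>0, 3 * \<beta>\<^sub>0)) \<or>
         ([b = c] (mod 3) \<and> (u, v) = (\<alpha>\<^sub>0 + \<beta>\<^sub>0, 3 * \<beta>\<^sub>0))"
    and "([d\<^sub>K = 0] (mod 4) \<and> C = (3, 0, d\<^sub>K div 4)) \<or>
         ([d\<^sub>K = 1] (mod 4) \<and> C = (3, 3, (d\<^sub>K + 3) div 4))"
  defines "G \<equiv> narrow_class_group (- 3 * d\<^sub>K)"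
    and "cl \<equiv> form_class (- 3 * d\<^sub>K)"
  shows "int_basis [u, v] (trace_zero_integers K) \<and>
    (\<exists>q. half_trace_form K u v q \<and>
         cl q \<in> carrier G \<and> cl C \<in> carrier G \<and> cl H \<in> carrier G \<and>
         (cl q \<otimes>\<^bsub>G\<^esub> cl C = cl H \<or> cl q \<otimes>\<^bsub>G\<^esub> cl C = inv\<^bsub>G\<^esub> (cl H)))"
proof -
  interpret R: cubic_order_basis K a b c d \<alpha> \<beta>
    unfolding assms(8,9) by (rule cubic_order_basis_root[OF assms(1,5,6,7)])
  have \<alpha>\<^sub>0: "\<alpha>\<^sub>0 = R.\<alpha>\<^sub>0" and \<beta>\<^sub>0: "\<beta>\<^sub>0 = R.\<beta>\<^sub>0"
    unfolding assms(10,11) R.\<alpha>\<^sub>0_def R.\<beta>\<^sub>0_def by simp_all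
  note fund = assms(3) and D3 = assms(4) and H = assms(12) and C = assms(14)
  have D: "d\<^sub>K = cubic_disc (a, b, c, d)"
    using R.discriminant_unique[OF assms(2)] D3 by fastforce
  \<comment> \<open>If 3 divided both, it would divide every term of the discriminant. So
    \<open>b m - c n\<close> is a nonzero linear form modulo 3.\<close>
  have bc: "\<not> (3 dvd b \<and> 3 dvd c)"
  proof
    assume "3 dvd b \<and> 3 dvd c"
    then obtain k l where kl: "b = 3 * k" "c = 3 * l" by (auto elim!: dvdE)
    have "d\<^sub>K = 3 * (27 * k ^ 2 * l ^ 2 - 36 * a * l ^ 3 - 36 * k ^ 3 * d - 9 * a ^ 2 * d ^ 2 + 54 * a * k * l * d)"
      unfolding D kl by (simp add: power2_eq_square power3_eq_cube)
    then show False using D3 by (metis dvd_triv_left)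
  qed
  have p3: "prime (3::int)" by simp
  \<comment> \<open>The common end of all four cases: \<open>(i, j)\<close> and
    \<open>(k, l)\<close> are the coordinates of \<open>u\<close> and \<open>v\<close>, and
    \<open>q\<close> is the Hessian on their lattice divided by 3.\<close>
  have conclude: ?thesis
    if uv: "u = of_int i * R.\<alpha>\<^sub>0 + of_int j * R.\<beta>\<^sub>0" "v = of_int k * R.\<alpha>\<^sub>0 + of_int l * R.\<beta>\<^sub>0"
      and det: "i * l - j * k \<noteq> 0"
      and lattice: "\<And>m n. 3 dvd m * b - n * c \<longleftrightarrow> (\<exists>x y. m = i * x + k * y \<and> n = j * x + l * y)"
      and q: "\<forall>x y. 3 * quad_eval q x y = quad_eval H (i * x + k * y) (j * x + l * y)"
      and cls: "q \<in> forms_of_disc (- 3 * d\<^sub>K)" "C \<in> forms_of_disc (- 3 * d\<^sub>K)" "H \<in> forms_of_disc (- 3 * d\<^sub>K)"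
        "form_class (- 3 * d\<^sub>K) q \<otimes>\<^bsub>narrow_class_group (- 3 * d\<^sub>K)\<^esub> form_class (- 3 * d\<^sub>K) C
          = form_class (- 3 * d\<^sub>K) H"
    for i j k l q
  proof -
    have "int_basis [u, v] (trace_zero_integers K)"
      unfolding uv by (rule R.int_basis_trace_zero_integers[OF det lattice])
    moreover have "half_trace_form K u v q"
      unfolding half_trace_form_def
    proof (intro allI)
      fix x y :: int
      have "of_int x * u + of_int y * v
        = of_int (i * x + k * y) * R.\<alpha>\<^sub>0 + of_int (j * x + l * y) * R.\<beta>\<^sub>0"
        unfolding uv by (simp add: algebra_simps)
      then have "field_trace K ((of_int x * u + of_int y * v) ^ 2) / 2
        = of_int (quad_eval H (i * x + k * y) (j * x + l * y)) / 3"
        by (simp only: R.half_trace_square H)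
      also have "\<dots> = of_int (3 * quad_eval q x y) / 3" using q by simp
      finally show "field_trace K ((of_int x * u + of_int y * v) ^ 2) / 2 = of_int (quad_eval q x y)"
        by simp
    qed
    ultimately show ?thesis
      unfolding G_def cl_def using cls form_class_in_carrier by blast
  qed
  have shear: ?thesis if t: "[b = t * c] (mod 3)" and uv: "u = R.\<alpha>\<^sub>0 + of_int t * R.\<beta>\<^sub>0" "v = 3 * R.\<beta>\<^sub>0" for t
  proof -
    from t obtain k where k: "b = t * c + 3 * k"
      by (metis cong_iff_lin cong_sym)
    have c3: "\<not> 3 dvd c" using bc k by auto
    have lattice: "3 dvd m * b - n * c \<longleftrightarrow> (\<exists>x y. m = 1 * x + 0 * y \<and> n = t * x + 3 * y)" for m n
    proof -
      \<comment> \<open>Modulo 3 the condition becomes \<open>c * (n - t * m) = 0\<close>, where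
        \<open>c\<close> can be cancelled.\<close>
      have "m * b - n * c = 3 * (m * k) - c * (n - t * m)" by (simp add: k algebra_simps)
      then have "3 dvd m * b - n * c \<longleftrightarrow> 3 dvd c * (n - t * m)" by (simp add: dvd_diff_right_iff)
      also have "\<dots> \<longleftrightarrow> 3 dvd n - t * m" using c3 prime_dvd_mult_iff[OF p3] by blast
      also have "\<dots> \<longleftrightarrow> (\<exists>y. n = t * m + 3 * y)" by (auto simp: dvd_def algebra_simps)
      finally show ?thesis by simp
    qed
    from half_trace_hessian_product_shear[OF fund D3 D H t C] obtain q
      where "\<forall>x y. 3 * quad_eval q x y = quad_eval H x (t * x + 3 * y)"
      "q \<in> forms_of_disc (- 3 * d\<^sub>K)" "C \<in> forms_of_disc (- 3 * d\<^sub>K)" "H \<in> forms_of_disc (- 3 * d\<^sub>K)"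
      "form_class (- 3 * d\<^sub>K) q \<otimes>\<^bsub>narrow_class_group (- 3 * d\<^sub>K)\<^esub> form_class (- 3 * d\<^sub>K) C
          = form_class (- 3 * d\<^sub>K) H" by blast
    then show ?thesis using conclude[of 1 t 0 3 q] lattice uv by simp
  qed
  have scale: ?thesis if c: "[c = 0] (mod 3)" and uv: "u = 3 * R.\<alpha>\<^sub>0" "v = R.\<beta>\<^sub>0"
  proof -
    from c obtain k where k: "c = 3 * k" by (auto simp: cong_0_iff)
    have b3: "\<not> 3 dvd b" using bc k by auto
    have lattice: "3 dvd m * b - n * c \<longleftrightarrow> (\<exists>x y. m = 3 * x + 0 * y \<and> n = 0 * x + 1 * y)" for m n
    proof -
      have "3 dvd n * c" by (simp add: k)
      then have "3 dvd m * b - n * c \<longleftrightarrow> 3 dvd m * b" by (simp add: dvd_diff_left_iff)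
      also have "\<dots> \<longleftrightarrow> 3 dvd m" using b3 prime_dvd_mult_iff[OF p3] by blast
      finally show ?thesis by (auto simp: dvd_def)
    qed
    from half_trace_hessian_product_scale[OF fund D3 D H c C] obtain q
      where "\<forall>x y. 3 * quad_eval q x y = quad_eval H (3 * x) y"
      "q \<in> forms_of_disc (- 3 * d\<^sub>K)" "C \<in> forms_of_disc (- 3 * d\<^sub>K)" "H \<in> forms_of_disc (- 3 * d\<^sub>K)"
      "form_class (- 3 * d\<^sub>K) q \<otimes>\<^bsub>narrow_class_group (- 3 * d\<^sub>K)\<^esub> form_class (- 3 * d\<^sub>K) C
          = form_class (- 3 * d\<^sub>K) H" by blast
    then show ?thesis using conclude[of 3 0 0 1 q] lattice uv by simp
  qed
  \<comment> \<open>The congruences \<open>b = 0\<close>, \<open>b = - c\<close> and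
    \<open>b = c\<close> are \<open>b = t * c\<close> for \<open>t = 0, -1, 1\<close>; only
    \<open>c = 0\<close>, the point at infinity, needs the other basis shape.\<close>
  from assms(13) show ?thesis
    unfolding \<alpha>\<^sub>0 \<beta>\<^sub>0
    using shear[of 0] shear[of "- 1"] shear[of 1] scale by auto
qed

end
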